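(* Let $k\in\mathbb{C}$, $k\neq 0$, and consider the morphisms of complex analytic supermanifolds $P_\pm:(\mathbb{C}^{1|1})^\times_k\to(\mathbb{C}^{1|1})^\times_k$ given by $$P_\pm(w,\eta)=(w^{-1},\ \pm i\,w^{-2}\eta),$$ where $(w,\eta)$ are the global coordinates. Then $P_+$ and $P_-$ are automorphisms of the complex analytic supergroup $(\mathbb{C}^{1|1})^\times_k$. Furthermore, they are the unique SUSY-1 structure preserving endomorphisms of the complex supermanifold $(\mathbb{C}^{1|1})^\times$ that restrict to $w\mapsto w^{-1}$ on the reduced group $\mathbb{C}^\times$.
   Context: $(\mathbb{C}^{1|1})^\times=(\mathbb{C}^\times,\mathcal{O}_{\mathbb{C}^{1|1}}|_{\mathbb{C}^\times})$ is the open complex subsupermanifold of $\mathbb{C}^{1|1}$ over $\mathbb{C}^\times$, with even coordinate $w$ and odd coordinate $\eta$. $(\mathbb{C}^{1|1})^\times_k$ denotes it with the supergroup law (on $T$-points) $(w,\eta)\cdot(w',\eta')=(ww'+k\eta\eta',\,w\eta'+w'\eta)$. A SUSY-1 structure on a $1|1$-dimensional complex supermanifold $X$ is a rank $0|1$ holomorphic distribution $\mathcal{D}\subseteq TX$ such that the Frobenius map $\mathcal{D}\otimes\mathcal{D}\to TX/\mathcal{D}$, $Y\otimes Z\mapsto [Y,Z]\bmod\mathcal{D}$, is an isomorphism. The SUSY-1 structure considered on $(\mathbb{C}^{1|1})^\times_k$ is the right-invariant one spanned by the odd vector field $Z_k=k\eta\,\partial_w+w\,\partial_\eta$; equivalently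 it is the kernel of the differential form $\omega_k=w\,dw-k\,\eta\,d\eta$. A morphism $F:(\mathbb{C}^{1|1})^\times\to(\mathbb{C}^{1|1})^\times$ of complex supermanifolds is said to preserve the SUSY-1 structure if and only if $F^*(\omega_k)=h\,\omega_k$ for some even invertible holomorphic function $h$. *)

theory Defs
  imports "HOL-Analysis.Analysis" "HOL-Algebra.Module"
begin

section \<open>Super ringed spaces over the complex numbers\<close>

definition complex_field :: "complex ring" where
  "complex_field = \<lparr>carrier = UNIV, mult = (*), one = 1, zero = 0, add = (+)\<rparr>"

text \<open>A supercommutative complex superalgebra. The grading is indexed by \<open>bool\<close>:
  \<open>gr False\<close> is the even part and \<open>gr True\<close> the odd part.\<close>

definition super_algebra :: "(complex, 's) module \<Rightarrow> (bool \<Rightarrow> 's set) \<Rightarrow> bool" where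
  "super_algebra A gr \<longleftrightarrow>
     ring A \<and> Module.module complex_field A \<and>
     (\<forall>c. \<forall>a\<in>carrier A. \<forall>b\<in>carrier A.
        (c \<odot>\<^bsub>A\<^esub> a) \<otimes>\<^bsub>A\<^esub> b = c \<odot>\<^bsub>A\<^esub> (a \<otimes>\<^bsub>A\<^esub> b) \<and>
        a \<otimes>\<^bsub>A\<^esub> (c \<odot>\<^bsub>A\<^esub> b) = c \<odot>\<^bsub>A\<^esub> (a \<otimes>\<^bsub>A\<^esub> b)) \<and>
     (\<forall>i. submodule (gr i) complex_field A) \<and>
     (\<forall>a\<in>carrier A. \<exists>!(e, d). e \<in> gr False \<and> d \<in> gr True \<and> a = e \<oplus>\<^bsub>A\<^esub> d) \<and>
     \<one>\<^bsub>A\<^esub> \<in> gr False \<and>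
     (\<forall>i j. \<forall>a\<in>gr i. \<forall>b\<in>gr j. a \<otimes>\<^bsub>A\<^esub> b \<in> gr (i \<noteq> j)) \<and>
     (\<forall>i j. \<forall>a\<in>gr i. \<forall>b\<in>gr j.
        a \<otimes>\<^bsub>A\<^esub> b = (if i \<and> j then \<ominus>\<^bsub>A\<^esub> (b \<otimes>\<^bsub>A\<^esub> a) else b \<otimes>\<^bsub>A\<^esub> a))"

definition super_hom ::
  "(complex, 's) module \<Rightarrow> (bool \<Rightarrow> 's set) \<Rightarrow> (complex, 't) module \<Rightarrow> (bool \<Rightarrow> 't set)
    \<Rightarrow> ('s \<Rightarrow> 't) \<Rightarrow> bool" where
  "super_hom A gr B gr' h \<longleftrightarrow>
     h \<in> ring_hom A B \<and>
     (\<forall>c. \<forall>a\<in>carrier A. h (c \<odot>\<^bsub>A\<^esub> a) = c \<odot>\<^bsub>B\<^esub> h a) \<and>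
     (\<forall>i. h ` gr i \<subseteq> gr' i)"

text \<open>\<open>str X U\<close> is the algebra of sections of the structure sheaf over \<open>U\<close>, \<open>grade X U\<close> its
  grading, and \<open>rest X U V\<close> the restriction from \<open>U\<close> to \<open>V \<subseteq> U\<close>. Only the values at open sets matter.\<close>

record ('p, 's) super_space =
  pts :: "'p topology"
  str :: "'p set \<Rightarrow> (complex, 's) module"
  grade :: "'p set \<Rightarrow> bool \<Rightarrow> 's set"
  rest :: "'p set \<Rightarrow> 'p set \<Rightarrow> 's \<Rightarrow> 's"

abbreviation sections :: "('p, 's) super_space \<Rightarrow> 'p set \<Rightarrow> 's set" where
  "sections X U \<equiv> carrier (str X U)"

definition super_presheaf :: "('p, 's) super_space \<Rightarrow> bool" where
  "super_presheaf X \<longleftrightarrow>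
     (\<forall>U. openin (pts X) U \<longrightarrow> super_algebra (str X U) (grade X U)) \<and>
     (\<forall>U V. openin (pts X) U \<and> openin (pts X) V \<and> V \<subseteq> U \<longrightarrow>
        super_hom (str X U) (grade X U) (str X V) (grade X V) (rest X U V)) \<and>
     (\<forall>U. openin (pts X) U \<longrightarrow> (\<forall>a\<in>sections X U. rest X U U a = a)) \<and>
     (\<forall>U V W. openin (pts X) U \<and> openin (pts X) V \<and> openin (pts X) W \<and> W \<subseteq> V \<and> V \<subseteq> U \<longrightarrow>
        (\<forall>a\<in>sections X U. rest X V W (rest X U V a) = rest X U W a))"

definition sheaf_condition :: "('p, 's) super_space \<Rightarrow> bool" where
  "sheaf_condition X \<longleftrightarrow>
     (\<forall>\<U>. (\<forall>U\<in>\<U>. openin (pts X) U) \<longrightarrow>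
        (\<forall>s. (\<forall>U\<in>\<U>. s U \<in> sections X U) \<and>
             (\<forall>U\<in>\<U>. \<forall>V\<in>\<U>. rest X U (U \<inter> V) (s U) = rest X V (U \<inter> V) (s V)) \<longrightarrow>
             (\<exists>!a. a \<in> sections X (\<Union>\<U>) \<and> (\<forall>U\<in>\<U>. rest X (\<Union>\<U>) U a = s U))))"

text \<open>Invertibility of the germ at \<open>x\<close> of a section over \<open>U\<close>. Germs are units iff some
  representative is a unit, so stalks need not be formed explicitly.\<close>

definition germ_unit :: "('p, 's) super_space \<Rightarrow> 'p \<Rightarrow> 'p set \<Rightarrow> 's \<Rightarrow> bool" where
  "germ_unit X x U a \<longleftrightarrow>
     (\<exists>W. openin (pts X) W \<and> x \<in> W \<and> W \<subseteq> U \<and> rest X U W a \<in> Units (str X W))"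

text \<open>The stalks are local rings: they are nonzero, and if a sum of two germs is a unit, so is one
  of the summands.\<close>

definition local_stalks :: "('p, 's) super_space \<Rightarrow> bool" where
  "local_stalks X \<longleftrightarrow>
     (\<forall>U x. openin (pts X) U \<and> x \<in> U \<longrightarrow>
        \<one>\<^bsub>str X U\<^esub> \<noteq> \<zero>\<^bsub>str X U\<^esub> \<and>
        (\<forall>a\<in>sections X U. \<forall>b\<in>sections X U.
           germ_unit X x U (a \<oplus>\<^bsub>str X U\<^esub> b) \<longrightarrow> germ_unit X x U a \<or> germ_unit X x U b))"

definition super_ringed_space :: "('p, 's) super_space \<Rightarrow> bool" where
  "super_ringed_space X \<longleftrightarrow> super_presheaf X \<and> sheaf_condition X \<and> local_stalks X"

definition open_sub :: "('p, 's) super_space \<Rightarrow> 'p set \<Rightarrow> ('p, 's) super_space" where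
  "open_sub X U = X\<lparr>pts := subtopology (pts X) U\<rparr>"


section \<open>Morphisms\<close>

text \<open>\<open>pull F V\<close> maps sections over \<open>V\<close> to sections over the preimage of \<open>V\<close>. All components are
  required to be \<open>extensional\<close>, so that equality of morphisms is equality of records.\<close>

record ('p, 's, 'q, 't) super_map =
  body :: "'p \<Rightarrow> 'q"
  pull :: "'q set \<Rightarrow> 't \<Rightarrow> 's"

definition preim :: "('p, 's) super_space \<Rightarrow> ('p, 's, 'q, 't) super_map \<Rightarrow> 'q set \<Rightarrow> 'p set" where
  "preim X F V = {x \<in> topspace (pts X). body F x \<in> V}"

definition super_morphism ::
  "('p, 's) super_space \<Rightarrow> ('q, 't) super_space \<Rightarrow> ('p, 's, 'q, 't) super_map \<Rightarrow> bool" where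
  "super_morphism X Y F \<longleftrightarrow>
     continuous_map (pts X) (pts Y) (body F) \<and>
     body F \<in> extensional (topspace (pts X)) \<and>
     pull F \<in> extensional {V. openin (pts Y) V} \<and>
     (\<forall>V. openin (pts Y) V \<longrightarrow>
        pull F V \<in> extensional (sections Y V) \<and>
        super_hom (str Y V) (grade Y V) (str X (preim X F V)) (grade X (preim X F V)) (pull F V)) \<and>
     (\<forall>V W. openin (pts Y) V \<and> openin (pts Y) W \<and> W \<subseteq> V \<longrightarrow>
        (\<forall>a\<in>sections Y V.
           rest X (preim X F V) (preim X F W) (pull F V a) = pull F W (rest Y V W a))) \<and>
     (\<forall>V x. openin (pts Y) V \<and> x \<in> preim X F V \<longrightarrow>
        (\<forall>a\<in>sections Y V.
           germ_unit X x (preim X F V) (pull F V a) \<longrightarrow> germ_unit Y (body F x) V a))"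

definition super_id :: "('p, 's) super_space \<Rightarrow> ('p, 's, 'p, 's) super_map" where
  "super_id X =
     \<lparr>body = (\<lambda>x\<in>topspace (pts X). x),
      pull = (\<lambda>V\<in>{V. openin (pts X) V}. \<lambda>a\<in>sections X V. a)\<rparr>"

text \<open>\<open>super_comp X Y Z F' F\<close> is the composite of \<open>F : X \<rightarrow> Y\<close> and \<open>F' : Y \<rightarrow> Z\<close>.\<close>

definition super_comp ::
  "('p, 's) super_space \<Rightarrow> ('q, 't) super_space \<Rightarrow> ('r, 'u) super_space \<Rightarrow>
   ('q, 't, 'r, 'u) super_map \<Rightarrow> ('p, 's, 'q, 't) super_map \<Rightarrow> ('p, 's, 'r, 'u) super_map" where
  "super_comp X Y Z F' F =
     \<lparr>body = (\<lambda>x\<in>topspace (pts X). body F' (body F x)),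
      pull = (\<lambda>V\<in>{V. openin (pts Z) V}. \<lambda>a\<in>sections Z V. pull F (preim Y F' V) (pull F' V a))\<rparr>"

definition super_iso ::
  "('p, 's) super_space \<Rightarrow> ('q, 't) super_space \<Rightarrow> ('p, 's, 'q, 't) super_map \<Rightarrow> bool" where
  "super_iso X Y F \<longleftrightarrow>
     super_morphism X Y F \<and>
     (\<exists>F'. super_morphism Y X F' \<and>
        super_comp X Y X F' F = super_id X \<and> super_comp Y X Y F F' = super_id Y)"


section \<open>Complex supermanifolds\<close>

text \<open>Since the dimension \<open>p\<close> is quantified, \<open>\<complex>\<^sup>p\<close> is realised as the subspace of sequences
  vanishing from index \<open>p\<close> on, with the product topology.\<close>

definition cspace :: "nat \<Rightarrow> (nat \<Rightarrow> complex) topology" where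
  "cspace p = top_of_set {x. \<forall>i\<ge>p. x i = 0}"

text \<open>Holomorphy in several variables, in the form of Caratheodory:
  \<open>f x - f a = (\<Sum>i<p. (x i - a i) * D i x)\<close> with every \<open>D i\<close> continuous at \<open>a\<close>.\<close>

definition holo :: "nat \<Rightarrow> (nat \<Rightarrow> complex) set \<Rightarrow> ((nat \<Rightarrow> complex) \<Rightarrow> complex) \<Rightarrow> bool" where
  "holo p V f \<longleftrightarrow>
     (\<forall>a\<in>V. \<exists>D. (\<forall>i<p. (D i \<longlongrightarrow> D i a) (at a within V)) \<and>
        (\<forall>x\<in>V. f x = f a + (\<Sum>i<p. (x i - a i) * D i x)))"

text \<open>A section \<open>a\<close> of \<open>\<O> \<otimes> \<Lambda>[\<eta>\<^sub>0, \<dots>, \<eta>\<^sub>q\<^sub>-\<^sub>1]\<close> over \<open>V\<close> stands for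
  \<open>\<Sum>I\<subseteq>{..<q}. a I \<cdot> \<eta>\<^sub>I\<close>, where \<open>\<eta>\<^sub>I\<close> is the product of the \<open>\<eta>\<^sub>i\<close>, \<open>i \<in> I\<close>, in increasing order.
  Coefficients are extended by 0 outside \<open>V\<close>. One has
  \<open>\<eta>\<^sub>I \<eta>\<^sub>J = grassmann_sign I J \<cdot> \<eta>\<^sub>I\<^sub>\<union>\<^sub>J\<close> for disjoint \<open>I\<close>, \<open>J\<close>.\<close>

type_synonym gsection = "nat set \<Rightarrow> (nat \<Rightarrow> complex) \<Rightarrow> complex"

definition grassmann_sign :: "nat set \<Rightarrow> nat set \<Rightarrow> complex" where
  "grassmann_sign I J = (- 1) ^ card {(i, j). i \<in> I \<and> j \<in> J \<and> j < i}"

definition gsections :: "nat \<Rightarrow> nat \<Rightarrow> (nat \<Rightarrow> complex) set \<Rightarrow> gsection set" where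
  "gsections p q V =
     {a. (\<forall>I x. a I x \<noteq> 0 \<longrightarrow> I \<subseteq> {..<q} \<and> x \<in> V) \<and> (\<forall>I. I \<subseteq> {..<q} \<longrightarrow> holo p V (a I))}"

definition cspace_super :: "nat \<Rightarrow> nat \<Rightarrow> (nat \<Rightarrow> complex, gsection) super_space" where
  "cspace_super p q =
     \<lparr>pts = cspace p,
      str = (\<lambda>V. \<lparr>carrier = gsections p q V,
                  mult = (\<lambda>a b K x. \<Sum>I\<in>Pow K. grassmann_sign I (K - I) * a I x * b (K - I) x),
                  one = (\<lambda>I x. if I = {} \<and> x \<in> V then 1 else 0),
                  zero = (\<lambda>I x. 0),
                  add = (\<lambda>a b I x. a I x + b I x),
                  smult = (\<lambda>c a I x. c * a I x)\<rparr>),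
      grade = (\<lambda>V odd_part. {a \<in> gsections p q V. \<forall>I. a I \<noteq> (\<lambda>x. 0) \<longrightarrow> (odd (card I) \<longleftrightarrow> odd_part)}),
      rest = (\<lambda>U V a I x. if x \<in> V then a I x else 0)\<rparr>"

definition complex_supermanifold :: "nat \<Rightarrow> nat \<Rightarrow> ('p, 's) super_space \<Rightarrow> bool" where
  "complex_supermanifold p q X \<longleftrightarrow>
     super_ringed_space X \<and> Hausdorff_space (pts X) \<and> second_countable (pts X) \<and>
     (\<forall>x\<in>topspace (pts X). \<exists>U D F.
        openin (pts X) U \<and> x \<in> U \<and> openin (cspace p) D \<and>
        super_iso (open_sub X U) (open_sub (cspace_super p q) D) F)"


section \<open>The supergroup of units\<close>

text \<open>The identification of \<open>\<complex>\<close> with the point set of \<open>\<complex>\<^sup>1\<^sup>|\<^sup>1\<close>.\<close>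

definition pt :: "complex \<Rightarrow> nat \<Rightarrow> complex" where
  "pt z = (\<lambda>i. if i = 0 then z else 0)"

definition Gpts :: "(nat \<Rightarrow> complex) set" where
  "Gpts = pt ` (- {0})"

definition Gsp :: "(nat \<Rightarrow> complex, gsection) super_space" where
  "Gsp = open_sub (cspace_super 1 1) Gpts"

abbreviation OG :: "(complex, gsection) module" where
  "OG \<equiv> str Gsp Gpts"

text \<open>The global coordinates \<open>w\<close> (even) and \<open>\<eta>\<close> (odd).\<close>

definition gen_w :: gsection where
  "gen_w = (\<lambda>I x. if I = {} \<and> x \<in> Gpts then x 0 else 0)"

definition gen_eta :: gsection where
  "gen_eta = (\<lambda>I x. if I = {0} \<and> x \<in> Gpts then 1 else 0)"

type_synonym ('p, 's) G_point = "('p, 's, nat \<Rightarrow> complex, gsection) super_map"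

type_synonym G_endo = "(nat \<Rightarrow> complex, gsection) G_point"

text \<open>The coordinates of a \<open>T\<close>-point of \<open>Gsp\<close>, i.e. the pulled back global coordinates.\<close>

abbreviation coord_w :: "('p, 's) G_point \<Rightarrow> 's" where
  "coord_w F \<equiv> pull F Gpts gen_w"

abbreviation coord_eta :: "('p, 's) G_point \<Rightarrow> 's" where
  "coord_eta F \<equiv> pull F Gpts gen_eta"

text \<open>The graph of the group law \<open>(w, \<eta>) \<cdot> (w', \<eta>') = (w w' + k \<eta> \<eta>', w \<eta>' + w' \<eta>)\<close> on the
  \<open>T\<close>-points of \<open>Gsp\<close>: \<open>c = a \<cdot> b\<close>. On a supermanifold \<open>T\<close> a
  \<open>T\<close>-point is determined by its coordinates, and every invertible even and odd section occur.\<close>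

definition is_product ::
  "complex \<Rightarrow> ('p, 's) super_space \<Rightarrow> ('p, 's) G_point \<Rightarrow> ('p, 's) G_point \<Rightarrow> ('p, 's) G_point \<Rightarrow> bool"
  where
  "is_product k T a b c \<longleftrightarrow>
     (let A = str T (topspace (pts T)) in
        coord_w c = coord_w a \<otimes>\<^bsub>A\<^esub> coord_w b \<oplus>\<^bsub>A\<^esub> k \<odot>\<^bsub>A\<^esub> (coord_eta a \<otimes>\<^bsub>A\<^esub> coord_eta b) \<and>
        coord_eta c = coord_w a \<otimes>\<^bsub>A\<^esub> coord_eta b \<oplus>\<^bsub>A\<^esub> coord_w b \<otimes>\<^bsub>A\<^esub> coord_eta a)"

definition hom_on_points :: "complex \<Rightarrow> ('p, 's) super_space \<Rightarrow> G_endo \<Rightarrow> bool" where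
  "hom_on_points k T F \<longleftrightarrow>
     (\<forall>a b c. super_morphism T Gsp a \<and> super_morphism T Gsp b \<and> super_morphism T Gsp c \<and>
        is_product k T a b c \<longrightarrow>
        is_product k T (super_comp T Gsp Gsp F a) (super_comp T Gsp Gsp F b) (super_comp T Gsp Gsp F c))"

text \<open>The type argument fixes the types of points and of sections of the test supermanifolds \<open>T\<close>;
  it is meant to be left polymorphic.\<close>

definition supergroup_automorphism :: "('p, 's) super_space itself \<Rightarrow> complex \<Rightarrow> G_endo \<Rightarrow> bool" where
  "supergroup_automorphism TT k F \<longleftrightarrow>
     super_iso Gsp Gsp F \<and>
     (\<forall>p q. \<forall>T::('p, 's) super_space. complex_supermanifold p q T \<longrightarrow> hom_on_points k T F)"

text \<open>The morphism \<open>(w, \<eta>) \<mapsto> (w\<^sup>-\<^sup>1, c w\<^sup>-\<^sup>2 \<eta>)\<close>.\<close>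

definition inversion :: "complex \<Rightarrow> G_endo" where
  "inversion c =
     (THE F. super_morphism Gsp Gsp F \<and>
        coord_w F = inv\<^bsub>OG\<^esub> gen_w \<and>
        coord_eta F = c \<odot>\<^bsub>OG\<^esub> ((inv\<^bsub>OG\<^esub> gen_w [^]\<^bsub>OG\<^esub> (2::nat)) \<otimes>\<^bsub>OG\<^esub> gen_eta))"

definition P_plus :: G_endo where
  "P_plus = inversion \<i>"

definition P_minus :: G_endo where
  "P_minus = inversion (- \<i>)"


section \<open>Differential forms and the SUSY-1 structure\<close>

text \<open>The pair \<open>(A, B)\<close> stands for the global 1-form \<open>A dw + B d\<eta>\<close> on \<open>Gsp\<close>.\<close>

type_synonym gform = "gsection \<times> gsection"

definition partial_w :: "gsection \<Rightarrow> gsection" where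
  "partial_w a = (\<lambda>I x. if x \<in> Gpts then deriv (\<lambda>z. a I (pt z)) (x 0) else 0)"

definition partial_eta :: "gsection \<Rightarrow> gsection" where
  "partial_eta a = (\<lambda>I x. if I = {} then a {0} x else 0)"

text \<open>\<open>d (f + g \<eta>) = (f' + g' \<eta>) dw + g d\<eta>\<close>, with \<open>dw\<close> and \<open>\<eta>\<close> commuting. The opposite
  sign convention changes the sign of \<open>g' \<eta> dw\<close> only; in \<open>F\<^sup>*(\<omega>\<^sub>k)\<close> this term is multiplied
  by a multiple of \<open>\<eta>\<close> and so vanishes.\<close>

definition ext_d :: "gsection \<Rightarrow> gform" where
  "ext_d a = (partial_w a, partial_eta a)"

definition form_add :: "gform \<Rightarrow> gform \<Rightarrow> gform" where
  "form_add \<alpha> \<beta> = (fst \<alpha> \<oplus>\<^bsub>OG\<^esub> fst \<beta>, snd \<alpha> \<oplus>\<^bsub>OG\<^esub> snd \<beta>)"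

definition form_mult :: "gsection \<Rightarrow> gform \<Rightarrow> gform" where
  "form_mult h \<alpha> = (h \<otimes>\<^bsub>OG\<^esub> fst \<alpha>, h \<otimes>\<^bsub>OG\<^esub> snd \<alpha>)"

definition form_pull :: "G_endo \<Rightarrow> gform \<Rightarrow> gform" where
  "form_pull F \<alpha> =
     form_add (form_mult (pull F Gpts (fst \<alpha>)) (ext_d (coord_w F)))
              (form_mult (pull F Gpts (snd \<alpha>)) (ext_d (coord_eta F)))"

definition susy_form :: "complex \<Rightarrow> gform" where
  "susy_form k = (gen_w, (- k) \<odot>\<^bsub>OG\<^esub> gen_eta)"

definition preserves_susy :: "complex \<Rightarrow> G_endo \<Rightarrow> bool" where
  "preserves_susy k F \<longleftrightarrow>
     (\<exists>h \<in> grade Gsp Gpts False \<inter> Units OG. form_pull F (susy_form k) = form_mult h (susy_form k))"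

end

theory Submission
  imports Defs
begin

text \<open>A section over \<open>V\<close> is a pair \<open>f + g \<eta>\<close> of holomorphic functions, so an even section is just a
  function. Locality of a morphism \<open>F\<close> on stalks forces \<open>F\<^sup>* f = f \<circ> \<phi>\<close> for even sections, where \<open>\<phi>\<close> is
  the underlying map, and \<open>F\<^sup>* \<eta> = g \<eta>\<close> for some \<open>g\<close>; hence endomorphisms correspond to pairs \<open>(\<phi>, g)\<close>.
  In these terms \<open>F\<^sup>* \<omega>\<^sub>k = \<phi> \<phi>' dw - k g\<^sup>2 \<eta> d\<eta>\<close>, which is a multiple of \<open>w dw - k \<eta> d\<eta>\<close> iff
  \<open>\<phi> \<phi>' = g\<^sup>2 w\<close>. For \<open>\<phi> = w\<^sup>-\<^sup>1\<close> this says \<open>(g w\<^sup>2)\<^sup>2 = -1\<close>, and \<open>g w\<^sup>2\<close> is constant because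
  the punctured plane is connected.\<close>

section \<open>Supercommutative algebras\<close>

text \<open>It serves the global sections of a test supermanifold \<open>T\<close>, which have no
  normal form like that on \<open>Gsp\<close>; the group law has to be checked from the axioms of
  \<open>super_algebra\<close>.\<close>

locale supercommutative =
  fixes A :: "(complex, 's) module" (structure) and gr :: "bool \<Rightarrow> 's set"
  assumes super_algebra: "super_algebra A gr"
begin

sublocale ring A
  using super_algebra by (simp add: super_algebra_def)

lemma module: "Module.module complex_field A"
  using super_algebra by (simp add: super_algebra_def)

lemma complex_field_simps [simp]:
  "carrier complex_field = UNIV" "mult complex_field = (*)" "one complex_field = 1"
  "add complex_field = (+)" "zero complex_field = 0"
  by (simp_all add: complex_field_def)

lemma smult_closed [simp, intro]: "a \<in> carrier A \<Longrightarrow> c \<odot> a \<in> carrier A"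
  using module.smult_closed[OF module] by simp

lemma smult_smult [simp]: "a \<in> carrier A \<Longrightarrow> c \<odot> (d \<odot> a) = (c * d) \<odot> a"
  using module.smult_assoc1[OF module, of c d a] by simp

lemma smult_one [simp]: "a \<in> carrier A \<Longrightarrow> 1 \<odot> a = a"
  using module.smult_one[OF module, of a] by simp

lemma smult_add: "a \<in> carrier A \<Longrightarrow> b \<in> carrier A \<Longrightarrow> c \<odot> (a \<oplus> b) = c \<odot> a \<oplus> c \<odot> b"
  using module.smult_r_distr[OF module, of c a b] by simp

lemma add_smult: "a \<in> carrier A \<Longrightarrow> (c + d) \<odot> a = c \<odot> a \<oplus> d \<odot> a"
  using module.smult_l_distr[OF module, of c d a] by simp

lemma smult_zero [simp]: "c \<odot> \<zero> = \<zero>"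
  using smult_add[of \<zero> \<zero> c] by simp

lemma zero_smult [simp]: "a \<in> carrier A \<Longrightarrow> 0 \<odot> a = \<zero>"
  using add_smult[of a 0 0] by simp

lemma smult_mult [simp]:
  "a \<in> carrier A \<Longrightarrow> b \<in> carrier A \<Longrightarrow> (c \<odot> a) \<otimes> b = c \<odot> (a \<otimes> b)"
  "a \<in> carrier A \<Longrightarrow> b \<in> carrier A \<Longrightarrow> a \<otimes> (c \<odot> b) = c \<odot> (a \<otimes> b)"
  using super_algebra by (simp_all add: super_algebra_def)

lemma grade_closed: "a \<in> gr i \<Longrightarrow> a \<in> carrier A"
proof -
  have "submodule (gr i) complex_field A"
    using super_algebra unfolding super_algebra_def by blast
  then show "a \<in> gr i \<Longrightarrow> a \<in> carrier A"
    using module.submoduleE(1)[OF module] by blast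
qed

lemma grade_commute:
  assumes "a \<in> gr i" "b \<in> gr j"
  shows "a \<otimes> b = (if i \<and> j then \<ominus> (b \<otimes> a) else b \<otimes> a)"
proof -
  have "\<forall>i j. \<forall>a\<in>gr i. \<forall>b\<in>gr j. a \<otimes> b = (if i \<and> j then \<ominus> (b \<otimes> a) else b \<otimes> a)"
    using super_algebra unfolding super_algebra_def by (elim conjE)
  with assms show ?thesis
    by blast
qed

lemma odd_commute: "a \<in> gr True \<Longrightarrow> b \<in> gr True \<Longrightarrow> a \<otimes> b = \<ominus> (b \<otimes> a)"
  using grade_commute[of a True b True] by simp

lemma even_commute_homogeneous: "a \<in> gr False \<Longrightarrow> b \<in> gr i \<Longrightarrow> a \<otimes> b = b \<otimes> a"
  using grade_commute[of a False b i] by simp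

text \<open>The sign rule speaks of homogeneous elements only; splitting \<open>b\<close> into its
  even and odd part extends it, since an even \<open>a\<close> commutes with both without a
  sign.\<close>

lemma even_commute:
  assumes a: "a \<in> gr False" and b: "b \<in> carrier A"
  shows "a \<otimes> b = b \<otimes> a"
proof -
  have "\<forall>a\<in>carrier A. \<exists>!(e, d). e \<in> gr False \<and> d \<in> gr True \<and> a = e \<oplus> d"
    using super_algebra unfolding super_algebra_def by (elim conjE)
  from bspec[OF this b] obtain e d where "e \<in> gr False" "d \<in> gr True" "b = e \<oplus> d"
    by (auto dest: ex1_implies_ex)
  then show ?thesis
    using a even_commute_homogeneous by (simp add: l_distr r_distr grade_closed)
qed

lemma minus_eq_smult: "a \<in> carrier A \<Longrightarrow> \<ominus> a = (- 1) \<odot> a"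
  using add_smult[of a 1 "- 1"] by (simp add: minus_equality add.inv_equality a_comm)

text \<open>The sign rule makes \<open>a \<otimes> a\<close> its own negative, and \<open>2\<close>
  is an invertible scalar.\<close>

lemma odd_square:
  assumes "a \<in> gr True"
  shows "a \<otimes> a = \<zero>"
proof -
  have a: "a \<in> carrier A"
    using assms by (rule grade_closed)
  have "2 \<odot> (a \<otimes> a) = a \<otimes> a \<oplus> a \<otimes> a"
    using a add_smult[of "a \<otimes> a" 1 1] by simp
  also have "\<dots> = \<zero>"
    using odd_commute[OF assms assms] a by (metis m_closed r_neg)
  finally have "(1 / 2) \<odot> (2 \<odot> (a \<otimes> a)) = \<zero>"
    by simp
  then show ?thesis
    using a by simp
qed

text \<open>The two identities express that \<open>(w, \<eta>) \<mapsto> (w\<^sup>-\<^sup>1, c w\<^sup>-\<^sup>2 \<eta>)\<close> respects the group law: with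
  \<open>u = a\<^sup>-\<^sup>1 b\<^sup>-\<^sup>1\<close>, the inverse of \<open>a b + k \<alpha> \<beta>\<close> is \<open>u - k u\<^sup>2 \<alpha> \<beta>\<close>, where the factor \<open>-1\<close> is \<open>c\<^sup>2\<close>.\<close>

lemma inversion_product:
  assumes even: "a \<in> gr False" "a' \<in> gr False" "b \<in> gr False" "b' \<in> gr False" "e' \<in> gr False"
    and odd: "\<alpha> \<in> gr True" "\<beta> \<in> gr True"
    and inv: "a \<otimes> a' = \<one>" "b \<otimes> b' = \<one>" "(a \<otimes> b \<oplus> k \<odot> (\<alpha> \<otimes> \<beta>)) \<otimes> e' = \<one>"
    and c: "c ^ 2 = - 1"
  shows "e' = a' \<otimes> b' \<oplus> k \<odot> ((c \<odot> (a' \<otimes> a' \<otimes> \<alpha>)) \<otimes> (c \<odot> (b' \<otimes> b' \<otimes> \<beta>)))" (is ?inv)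
    and "c \<odot> (e' \<otimes> e' \<otimes> (a \<otimes> \<beta> \<oplus> b \<otimes> \<alpha>)) =
      a' \<otimes> (c \<odot> (b' \<otimes> b' \<otimes> \<beta>)) \<oplus> b' \<otimes> (c \<odot> (a' \<otimes> a' \<otimes> \<alpha>))" (is ?odd)
proof -
  have [simp]: "a \<in> carrier A" "a' \<in> carrier A" "b \<in> carrier A" "b' \<in> carrier A" "e' \<in> carrier A"
    "\<alpha> \<in> carrier A" "\<beta> \<in> carrier A"
    using even odd grade_closed by blast+
  \<comment> \<open>Together with \<open>m_assoc\<close> this lets the simplifier sort the even
    factors, which are central; odd factors keep their relative order.\<close>
  have lcomm: "x \<otimes> (y \<otimes> z) = y \<otimes> (x \<otimes> z)" if "x \<in> gr False" "y \<in> carrier A" "z \<in> carrier A" for x y z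
    using that even_commute[of x y] by (metis grade_closed m_assoc)
  note comm = even_commute[OF even(1)] even_commute[OF even(2)] even_commute[OF even(3)]
    even_commute[OF even(4)] even_commute[OF even(5)]
  have \<alpha>\<alpha> [simp]: "\<alpha> \<otimes> \<alpha> = \<zero>" and \<beta>\<beta> [simp]: "\<beta> \<otimes> \<beta> = \<zero>"
    using odd by (simp_all add: odd_square)
  have \<beta>\<alpha>: "\<beta> \<otimes> \<alpha> = (- 1) \<odot> (\<alpha> \<otimes> \<beta>)"
    using odd_commute[OF odd(2,1)] by (simp add: minus_eq_smult)
  have \<gamma>\<alpha>: "\<alpha> \<otimes> \<beta> \<otimes> \<alpha> = \<zero>"
    by (simp add: m_assoc \<beta>\<alpha>) (simp flip: m_assoc)
  have \<gamma>\<beta>: "\<alpha> \<otimes> \<beta> \<otimes> \<beta> = \<zero>"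
    by (simp add: m_assoc)
  \<comment> \<open>A product of two odd elements annihilates both of them and itself, so expansions
    in \<open>k \<odot> \<gamma>\<close> stop after the linear term.\<close>
  define \<gamma> where "\<gamma> = \<alpha> \<otimes> \<beta>"
  have \<gamma> [simp]: "\<gamma> \<in> carrier A" "\<gamma> \<otimes> \<alpha> = \<zero>" "\<gamma> \<otimes> \<beta> = \<zero>" "\<gamma> \<otimes> \<gamma> = \<zero>"
    using \<gamma>\<alpha> \<gamma>\<beta> by (simp_all add: \<gamma>_def) (metis \<gamma>\<alpha> \<open>\<alpha> \<in> carrier A\<close> \<open>\<beta> \<in> carrier A\<close> l_null m_assoc m_closed)
  define u where "u = a' \<otimes> b'"
  have u [simp]: "u \<in> carrier A"
    by (simp add: u_def)
  have u_comm: "x \<otimes> u = u \<otimes> x" if "x \<in> carrier A" for x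
    unfolding u_def using that even by (metis comm(2,4) grade_closed m_assoc)
  have vu: "a \<otimes> b \<otimes> u = \<one>"
  proof -
    have "a \<otimes> b \<otimes> u = (a \<otimes> a') \<otimes> (b \<otimes> b')"
      unfolding u_def using even(3) by (simp add: m_assoc lcomm)
    then show ?thesis
      by (simp add: inv)
  qed
  \<comment> \<open>The scalar \<open>c ^ 2 = - 1\<close> supplies the minus sign with which
    \<open>\<gamma>\<close> occurs in the inverse \<open>R\<close> below.\<close>
  have cc: "(c \<odot> (a' \<otimes> a' \<otimes> \<alpha>)) \<otimes> (c \<odot> (b' \<otimes> b' \<otimes> \<beta>)) = (- 1) \<odot> (u \<otimes> u \<otimes> \<gamma>)"
  proof -
    have "a' \<otimes> a' \<otimes> \<alpha> \<otimes> (b' \<otimes> b' \<otimes> \<beta>) = u \<otimes> u \<otimes> \<gamma>"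
      unfolding u_def \<gamma>_def using even by (simp add: m_assoc lcomm)
    then show ?thesis
      using c by (simp add: power2_eq_square)
  qed
  \<comment> \<open>The geometric series for the inverse of
    \<open>a \<otimes> b \<oplus> k \<odot> \<gamma>\<close>: \<open>u\<close> inverts
    \<open>a \<otimes> b\<close>, and the quadratic term vanishes with
    \<open>\<gamma> \<otimes> \<gamma>\<close>.\<close>
  define R where "R = u \<oplus> (- k) \<odot> (u \<otimes> u \<otimes> \<gamma>)"
  have R [simp]: "R \<in> carrier A"
    by (simp add: R_def)
  have "(a \<otimes> b \<oplus> k \<odot> \<gamma>) \<otimes> R = \<one>"
  proof -
    have "a \<otimes> b \<otimes> (u \<otimes> u \<otimes> \<gamma>) = u \<otimes> \<gamma>"
      using vu by (simp flip: m_assoc)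
    moreover have "\<gamma> \<otimes> (u \<otimes> u \<otimes> \<gamma>) = \<zero>"
      using u_comm[of \<gamma>] by (metis \<gamma>(1,4) m_assoc m_closed r_null u)
    moreover have "k \<odot> (u \<otimes> \<gamma>) \<oplus> (- k) \<odot> (u \<otimes> \<gamma>) = \<zero>"
      using add_smult[of "u \<otimes> \<gamma>" k "- k"] by simp
    ultimately show ?thesis
      unfolding R_def using vu u_comm[of \<gamma>]
      by (simp add: l_distr r_distr a_ac)
  qed
  \<comment> \<open>\<open>e'\<close> is assumed to be a right inverse; being even it is a left
    inverse too, hence equals the right inverse \<open>R\<close>.\<close>
  then have "e' = e' \<otimes> ((a \<otimes> b \<oplus> k \<odot> \<gamma>) \<otimes> R)"
    by simp
  also have "\<dots> = R"
    using inv(3) comm(5) by (simp add: \<gamma>_def flip: m_assoc)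
  finally have e': "e' = R" .
  then show ?inv
    unfolding cc R_def by (simp add: u_def[symmetric])
  \<comment> \<open>\<open>e'\<close> and \<open>u\<close> differ by a multiple of
    \<open>\<gamma>\<close>, which kills \<open>\<alpha>\<close> and \<open>\<beta>\<close>; so
    \<open>u\<close> may replace both copies of \<open>e'\<close>.\<close>
  have e\<alpha>: "e' \<otimes> \<alpha> = u \<otimes> \<alpha>" and e\<beta>: "e' \<otimes> \<beta> = u \<otimes> \<beta>"
    unfolding e' R_def by (simp_all add: l_distr m_assoc)
  have "e' \<otimes> e' \<otimes> (a \<otimes> \<beta> \<oplus> b \<otimes> \<alpha>) = a \<otimes> (e' \<otimes> (e' \<otimes> \<beta>)) \<oplus> b \<otimes> (e' \<otimes> (e' \<otimes> \<alpha>))"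
    using even by (simp add: r_distr m_assoc lcomm)
  also have "\<dots> = a \<otimes> (u \<otimes> (u \<otimes> \<beta>)) \<oplus> b \<otimes> (u \<otimes> (u \<otimes> \<alpha>))"
    using e\<alpha> e\<beta> u_comm[of e'] by (metis \<open>e' \<in> carrier A\<close> \<open>\<alpha> \<in> carrier A\<close> \<open>\<beta> \<in> carrier A\<close> m_assoc u)
  also have "a \<otimes> (u \<otimes> (u \<otimes> \<beta>)) = a' \<otimes> (b' \<otimes> b' \<otimes> \<beta>)"
  proof -
    have "a \<otimes> u = b'"
      unfolding u_def using inv(1) by (simp flip: m_assoc)
    then have "a \<otimes> (u \<otimes> (u \<otimes> \<beta>)) = b' \<otimes> (u \<otimes> \<beta>)"
      by (simp flip: m_assoc)
    then show ?thesis
      unfolding u_def using even by (simp add: m_assoc lcomm)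
  qed
  also have "b \<otimes> (u \<otimes> (u \<otimes> \<alpha>)) = b' \<otimes> (a' \<otimes> a' \<otimes> \<alpha>)"
  proof -
    have "b \<otimes> u = a'"
      unfolding u_def using inv(2) comm(2)[of b']
      by (simp flip: m_assoc)
    then have "b \<otimes> (u \<otimes> (u \<otimes> \<alpha>)) = a' \<otimes> (u \<otimes> \<alpha>)"
      by (simp flip: m_assoc)
    then show ?thesis
      unfolding u_def using even by (simp add: m_assoc lcomm)
  qed
  finally show ?odd
    by (simp add: smult_add)
qed

end

text \<open>Keeps the dimension in the form \<open>gsections 1 1\<close>.\<close>

declare One_nat_def [simp del]

section \<open>Sections of the structure sheaf as pairs of holomorphic functions\<close>

text \<open>The normal form \<open>f + g \<eta>\<close>. Values of \<open>f\<close> and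
  \<open>g\<close> outside \<open>S\<close> are discarded, so functions that agree on
  \<open>S\<close> give equal sections.\<close>

definition gsec :: "complex set \<Rightarrow> (complex \<Rightarrow> complex) \<Rightarrow> (complex \<Rightarrow> complex) \<Rightarrow> gsection" where
  "gsec S f g = (\<lambda>I x. if x \<in> pt ` S then if I = {} then f (x 0) else if I = {0} then g (x 0) else 0 else 0)"

lemma pt_0 [simp]: "pt z 0 = z"
  by (simp add: pt_def)

lemma inj_pt: "inj pt"
  by (metis injI pt_0)

lemma pt_eq_iff [simp]: "pt z = pt u \<longleftrightarrow> z = u"
  by (metis pt_0)

lemma pt_in_image_iff [simp]: "pt z \<in> pt ` S \<longleftrightarrow> z \<in> S"
  by (metis image_eqI imageE pt_0)

lemma range_pt: "range pt = {x. \<forall>i\<ge>1. x i = 0}"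
proof -
  have "x = pt (x 0)" if "\<forall>i\<ge>1. x i = 0" for x
    using that by (auto simp: pt_def fun_eq_iff One_nat_def)
  then show ?thesis
    by (force simp: pt_def)
qed

lemma continuous_on_pt: "continuous_on S pt"
proof (rule continuous_on_coordinatewise_then_product)
  show "continuous_on S (\<lambda>z. pt z i)" for i
    by (cases "i = 0") (auto simp: pt_def)
qed

lemma gsec_eq_iff: "gsec S f g = gsec S f' g' \<longleftrightarrow> (\<forall>z\<in>S. f z = f' z \<and> g z = g' z)"
proof
  assume eq: "gsec S f g = gsec S f' g'"
  show "\<forall>z\<in>S. f z = f' z \<and> g z = g' z"
  proof
    fix z assume "z \<in> S"
    then show "f z = f' z \<and> g z = g' z"
      using fun_cong[OF fun_cong[OF eq, of "{}"], of "pt z"] fun_cong[OF fun_cong[OF eq, of "{0}"], of "pt z"]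
      by (simp add: gsec_def)
  qed
qed (auto simp: gsec_def fun_eq_iff)

section \<open>The topology of the punctured plane\<close>

lemma pts_Gsp: "pts Gsp = top_of_set Gpts"
proof -
  have "Gpts \<subseteq> {x. \<forall>i\<ge>1. x i = 0}"
    unfolding Gpts_def range_pt[symmetric] by auto
  then show ?thesis
    by (simp add: Gsp_def open_sub_def cspace_super_def cspace_def subtopology_subtopology Int_absorb1)
qed

text \<open>\<open>pt\<close> is a homeomorphism onto its range with inverse the coordinate
  \<open>x 0\<close>; each direction takes a preimage under one of these two continuous
  maps.\<close>

lemma openin_Gsp_iff: "openin (pts Gsp) V \<longleftrightarrow> (\<exists>S. open S \<and> 0 \<notin> S \<and> V = pt ` S)"
proof
  assume "openin (pts Gsp) V"
  then obtain T where T: "open T" "V = Gpts \<inter> T"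
    by (auto simp: pts_Gsp openin_open)
  have "open (pt -` T)"
    using continuous_on_pt T(1) by (simp add: open_vimage)
  then have "open (pt -` T - {0})"
    by (simp add: open_delete)
  moreover have "V = pt ` (pt -` T - {0})"
    using T by (auto simp: Gpts_def)
  ultimately show "\<exists>S. open S \<and> 0 \<notin> S \<and> V = pt ` S"
    by blast
next
  assume "\<exists>S. open S \<and> 0 \<notin> S \<and> V = pt ` S"
  then obtain S where S: "open S" "0 \<notin> S" "V = pt ` S"
    by blast
  have "open ((\<lambda>x::nat \<Rightarrow> complex. x 0) -` S)"
    by (rule open_vimage) (use S in auto)
  moreover have "V = Gpts \<inter> (\<lambda>x. x 0) -` S"
    using S by (auto simp: Gpts_def)
  ultimately show "openin (pts Gsp) V"
    by (auto simp: pts_Gsp openin_open)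
qed

lemma topspace_Gsp [simp]: "topspace (pts Gsp) = Gpts"
  by (simp add: pts_Gsp)

lemma openin_Gsp_Gpts [simp]: "openin (pts Gsp) Gpts"
  using openin_topspace[of "pts Gsp"] by simp

lemma open_nonzero: "open (- {0 :: complex})"
  by auto

section \<open>Holomorphy in one complex variable\<close>

lemma filterlim_pt_at: "filterlim pt (at (pt z) within pt ` S) (at z within S)"
proof -
  have "(pt \<longlongrightarrow> pt z) (at z within S)"
    using continuous_on_pt[of UNIV] by (metis UNIV_I continuous_on_def tendsto_within_subset subset_UNIV)
  then show ?thesis
    unfolding filterlim_at by (auto simp: eventually_at_filter)
qed

text \<open>With \<open>filterlim_pt_at\<close> this transports limits of difference quotients
  between the plane and its image; injectivity of \<open>pt\<close> keeps the base point
  excluded.\<close>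

lemma filterlim_coord_at:
  "filterlim (\<lambda>x. x 0) (at z within S) (at (pt z) within pt ` S)"
proof -
  have "isCont (\<lambda>x::nat \<Rightarrow> complex. x 0) (pt z)"
    using continuous_on_eq_continuous_at[OF open_UNIV, THEN iffD1, OF continuous_on_product_coordinates]
    by (rule bspec) simp
  then have "((\<lambda>x. x 0) \<longlongrightarrow> z) (at (pt z) within pt ` S)"
    by (metis continuous_at_imp_continuous_at_within continuous_within pt_0)
  then show ?thesis
    unfolding filterlim_at by (auto simp: eventually_at_filter intro!: always_eventually)
qed

text \<open>In dimension one only \<open>D 0\<close> enters the sum; conversely a single factor is
  extended to a constant family.\<close>

lemma holo_1_alt:
  "holo 1 V f \<longleftrightarrow> (\<forall>a\<in>V. \<exists>D. (D \<longlongrightarrow> D a) (at a within V) \<and> (\<forall>x\<in>V. f x = f a + (x 0 - a 0) * D x))"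
proof -
  have "(\<exists>D::nat \<Rightarrow> (nat \<Rightarrow> complex) \<Rightarrow> complex. P (D 0)) \<longleftrightarrow> (\<exists>D. P D)" for P
  proof
    assume "\<exists>D. P D"
    then obtain D where "P D" ..
    then show "\<exists>D::nat \<Rightarrow> (nat \<Rightarrow> complex) \<Rightarrow> complex. P (D 0)"
      by (intro exI[of _ "\<lambda>_. D"])
  qed blast
  from this[of "\<lambda>D. (D \<longlongrightarrow> D a) (at a within V) \<and> (\<forall>x\<in>V. f x = f a + (x 0 - a 0) * D x)" for a]
  show ?thesis
    unfolding holo_def by (simp add: One_nat_def)
qed

text \<open>The Caratheodory factor is the difference quotient, filled in at the base point by the
  derivative; its continuity there is differentiability within \<open>S\<close>.\<close>

lemma holo_1_iff: "holo 1 (pt ` S) f \<longleftrightarrow> (f \<circ> pt) holomorphic_on S"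
proof
  assume L: "holo 1 (pt ` S) f"
  show "(f \<circ> pt) holomorphic_on S"
    unfolding holomorphic_on_def
  proof
    fix z assume z: "z \<in> S"
    from L z have "\<exists>D. (D \<longlongrightarrow> D (pt z)) (at (pt z) within pt ` S) \<and>
        (\<forall>x\<in>pt ` S. f x = f (pt z) + (x 0 - pt z 0) * D x)"
      unfolding holo_1_alt by (auto dest!: bspec[OF _ imageI[OF z]])
    then obtain D where D: "(D \<longlongrightarrow> D (pt z)) (at (pt z) within pt ` S)"
      and D': "\<forall>x\<in>pt ` S. f x = f (pt z) + (x 0 - pt z 0) * D x"
      by blast
    have eq: "(f (pt u) - f (pt z)) / (u - z) = D (pt u)" if "u \<in> S" "u \<noteq> z" for u
      using bspec[OF D' imageI[OF that(1)]] that(2) by simp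
    have "((D \<circ> pt) \<longlongrightarrow> D (pt z)) (at z within S)"
      unfolding comp_def by (rule filterlim_compose[OF D filterlim_pt_at])
    then have "((\<lambda>u. ((f \<circ> pt) u - (f \<circ> pt) z) / (u - z)) \<longlongrightarrow> D (pt z)) (at z within S)"
      by (rule Lim_transform_eventually) (use z in \<open>auto simp: eventually_at_filter eq\<close>)
    then show "(f \<circ> pt) field_differentiable (at z within S)"
      unfolding field_differentiable_def has_field_derivative_iff by blast
  qed
next
  assume R: "(f \<circ> pt) holomorphic_on S"
  show "holo 1 (pt ` S) f"
    unfolding holo_1_alt
  proof
    fix a assume "a \<in> pt ` S"
    then obtain z where z: "z \<in> S" "a = pt z"
      by blast
    obtain d where d: "((\<lambda>u. (f (pt u) - f (pt z)) / (u - z)) \<longlongrightarrow> d) (at z within S)"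
      using R z unfolding holomorphic_on_def field_differentiable_def has_field_derivative_iff by auto
    define D where "D = (\<lambda>x. if x = pt z then d else (f x - f (pt z)) / (x 0 - z))"
    have "((\<lambda>x. (f (pt (x 0)) - f (pt z)) / (x 0 - z)) \<longlongrightarrow> d) (at (pt z) within pt ` S)"
      by (rule filterlim_compose[OF d filterlim_coord_at])
    then have "(D \<longlongrightarrow> d) (at (pt z) within pt ` S)"
      by (rule Lim_transform_eventually) (auto simp: eventually_at_filter D_def intro!: always_eventually)
    then have "(D \<longlongrightarrow> D (pt z)) (at (pt z) within pt ` S)"
      by (simp add: D_def)
    moreover have "f x = f a + (x 0 - a 0) * D x" if "x \<in> pt ` S" for x
      using that z by (auto simp: D_def)
    ultimately show "\<exists>D. (D \<longlongrightarrow> D a) (at a within pt ` S) \<and>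
        (\<forall>x\<in>pt ` S. f x = f a + (x 0 - a 0) * D x)"
      using z by blast
  qed
qed

lemma subset_lessThan_1_iff: "I \<subseteq> {..<1::nat} \<longleftrightarrow> I = {} \<or> I = {0}"
  by auto

lemma gsec_in_gsections_iff [simp]:
  "gsec S f g \<in> gsections 1 1 (pt ` S) \<longleftrightarrow> f holomorphic_on S \<and> g holomorphic_on S"
proof -
  have "(gsec S f g {} \<circ> pt) holomorphic_on S \<longleftrightarrow> f holomorphic_on S"
       "(gsec S f g {0} \<circ> pt) holomorphic_on S \<longleftrightarrow> g holomorphic_on S"
    by (auto intro!: holomorphic_cong simp: gsec_def)
  moreover have "I \<subseteq> {..<1} \<and> x \<in> pt ` S" if "gsec S f g I x \<noteq> 0" for I x
    using that by (auto simp: gsec_def split: if_splits)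
  ultimately show ?thesis
    unfolding gsections_def subset_lessThan_1_iff by (auto simp: holo_1_iff)
qed

text \<open>The only index sets are \<open>{}\<close> and \<open>{0}\<close>, so two coefficient
  functions recover the section. Sheaf statements become statements about functions in this
  way.\<close>

lemma gsectionsE:
  assumes "a \<in> gsections 1 1 (pt ` S)"
  obtains f g where "f holomorphic_on S" "g holomorphic_on S" "a = gsec S f g"
proof -
  have "a = gsec S (a {} \<circ> pt) (a {0} \<circ> pt)"
  proof (intro ext)
    fix I x
    show "a I x = gsec S (a {} \<circ> pt) (a {0} \<circ> pt) I x"
      using assms unfolding gsections_def subset_lessThan_1_iff by (auto simp: gsec_def)
  qed
  then show ?thesis
    using that assms by (metis gsec_in_gsections_iff)
qed

section \<open>Algebra of sections\<close>

text \<open>\<open>open_sub\<close> shrinks the topology only, so all sections are computed in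
  \<open>cspace_super 1 1\<close>.\<close>

lemma str_Gsp: "str Gsp = str (cspace_super 1 1)"
  and grade_Gsp: "grade Gsp = grade (cspace_super 1 1)"
  and rest_Gsp: "rest Gsp = rest (cspace_super 1 1)"
  by (simp_all add: Gsp_def open_sub_def)

lemma sections_Gsp [simp]: "sections Gsp V = gsections 1 1 V"
  by (simp add: str_Gsp cspace_super_def)

lemma add_gsec [simp]:
  "gsec S f g \<oplus>\<^bsub>str Gsp V\<^esub> gsec S f' g' = gsec S (\<lambda>z. f z + f' z) (\<lambda>z. g z + g' z)"
  by (simp add: str_Gsp cspace_super_def gsec_def fun_eq_iff)

lemma smult_gsec [simp]:
  "c \<odot>\<^bsub>str Gsp V\<^esub> gsec S f g = gsec S (\<lambda>z. c * f z) (\<lambda>z. c * g z)"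
  by (simp add: str_Gsp cspace_super_def gsec_def fun_eq_iff)

lemma one_gsec: "\<one>\<^bsub>str Gsp (pt ` S)\<^esub> = gsec S (\<lambda>_. 1) (\<lambda>_. 0)"
  by (auto simp: str_Gsp cspace_super_def gsec_def fun_eq_iff)

text \<open>With one odd generator no reordering occurs: all relevant signs are \<open>1\<close>,
  and \<open>\<eta>^2 = 0\<close> leaves the product rule for \<open>f + g \<eta>\<close>.\<close>

lemma mult_gsec [simp]:
  "gsec S f g \<otimes>\<^bsub>str Gsp V\<^esub> gsec S f' g' = gsec S (\<lambda>z. f z * f' z) (\<lambda>z. f z * g' z + g z * f' z)"
proof (intro ext)
  fix K x
  let ?t = "\<lambda>I. grassmann_sign I (K - I) * gsec S f g I x * gsec S f' g' (K - I) x"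
  have "(\<Sum>I\<in>Pow K. ?t I) =
    gsec S (\<lambda>z. f z * f' z) (\<lambda>z. f z * g' z + g z * f' z) K x"
  proof (cases "x \<in> pt ` S")
    case True
    consider "K = {}" | "K = {0}" | "K \<noteq> {}" "K \<noteq> {0}"
      by blast
    then show ?thesis
    proof cases
      case 1
      with True show ?thesis
        by (simp add: gsec_def grassmann_sign_def)
    next
      case 2
      have [simp]: "grassmann_sign {} {0} = 1" "grassmann_sign {0} {} = 1"
        by (simp_all add: grassmann_sign_def)
      from 2 True show ?thesis
        by (simp add: gsec_def Pow_insert)
    next
      case 3
      \<comment> \<open>If \<open>I\<close> and \<open>K - I\<close> both lay in
        \<open>{{}, {0}}\<close>, so would their disjoint union \<open>K\<close>; hence one factor
        vanishes.\<close>
      have "?t I = 0" if "I \<in> Pow K" for I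
        using that 3 by (auto simp: gsec_def)
      then have "(\<Sum>I\<in>Pow K. ?t I) = 0"
        by (intro sum.neutral) blast
      with 3 show ?thesis
        by (simp add: gsec_def)
    qed
  qed (simp add: gsec_def)
  then show "(gsec S f g \<otimes>\<^bsub>str Gsp V\<^esub> gsec S f' g') K x =
    gsec S (\<lambda>z. f z * f' z) (\<lambda>z. f z * g' z + g z * f' z) K x"
    by (simp add: str_Gsp cspace_super_def)
qed

lemma rest_gsec [simp]: "S' \<subseteq> S \<Longrightarrow> rest Gsp V (pt ` S') (gsec S f g) = gsec S' f g"
  by (auto simp: rest_Gsp cspace_super_def gsec_def fun_eq_iff)

lemma gsec_in_grade_iff:
  "gsec S f g \<in> grade Gsp (pt ` S) i \<longleftrightarrow>
    f holomorphic_on S \<and> g holomorphic_on S \<and> (\<forall>z\<in>S. if i then f z = 0 else g z = 0)"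
proof -
  have "gsec S f g {} = (\<lambda>x. 0) \<longleftrightarrow> (\<forall>z\<in>S. f z = 0)" "gsec S f g {0} = (\<lambda>x. 0) \<longleftrightarrow> (\<forall>z\<in>S. g z = 0)"
    by (auto simp: gsec_def fun_eq_iff)
  moreover have "gsec S f g I = (\<lambda>x. 0)" if "I \<noteq> {}" "I \<noteq> {0}" for I
    using that by (auto simp: gsec_def)
  then have "(\<forall>I. gsec S f g I \<noteq> (\<lambda>x. 0) \<longrightarrow> (odd (card I) \<longleftrightarrow> i)) \<longleftrightarrow>
    (gsec S f g {} \<noteq> (\<lambda>x. 0) \<longrightarrow> \<not> i) \<and> (gsec S f g {0} \<noteq> (\<lambda>x. 0) \<longrightarrow> i)"
    by (metis card.empty card_1_singleton_iff even_zero odd_one One_nat_def)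
  ultimately show ?thesis
    by (auto simp: grade_Gsp cspace_super_def)
qed

section \<open>Units among sections and germs\<close>

lemma monoid_str_Gsp: "monoid (str Gsp (pt ` S))"
proof (rule monoidI)
  fix a b c assume "a \<in> sections Gsp (pt ` S)" "b \<in> sections Gsp (pt ` S)" "c \<in> sections Gsp (pt ` S)"
  then show "(a \<otimes>\<^bsub>str Gsp (pt ` S)\<^esub> b) \<otimes>\<^bsub>str Gsp (pt ` S)\<^esub> c = a \<otimes>\<^bsub>str Gsp (pt ` S)\<^esub> (b \<otimes>\<^bsub>str Gsp (pt ` S)\<^esub> c)"
    by (auto elim!: gsectionsE simp: gsec_eq_iff algebra_simps)
next
  fix a b assume "a \<in> sections Gsp (pt ` S)" "b \<in> sections Gsp (pt ` S)"
  then show "a \<otimes>\<^bsub>str Gsp (pt ` S)\<^esub> b \<in> sections Gsp (pt ` S)"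
    by (auto elim!: gsectionsE intro!: holomorphic_intros)
next
  show "\<one>\<^bsub>str Gsp (pt ` S)\<^esub> \<in> sections Gsp (pt ` S)"
    by (simp add: one_gsec)
next
  fix a assume "a \<in> sections Gsp (pt ` S)"
  then show "\<one>\<^bsub>str Gsp (pt ` S)\<^esub> \<otimes>\<^bsub>str Gsp (pt ` S)\<^esub> a = a" "a \<otimes>\<^bsub>str Gsp (pt ` S)\<^esub> \<one>\<^bsub>str Gsp (pt ` S)\<^esub> = a"
    by (auto elim!: gsectionsE simp: one_gsec)
qed

text \<open>The summand \<open>g \<eta>\<close> is nilpotent, so only \<open>f\<close> decides; the
  inverse is \<open>1/f - (g/f^2) \<eta>\<close>.\<close>

lemma gsec_in_Units_iff:
  assumes "f holomorphic_on S" "g holomorphic_on S"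
  shows "gsec S f g \<in> Units (str Gsp (pt ` S)) \<longleftrightarrow> (\<forall>z\<in>S. f z \<noteq> 0)"
proof
  assume "gsec S f g \<in> Units (str Gsp (pt ` S))"
  then show "\<forall>z\<in>S. f z \<noteq> 0"
    by (force simp: Units_def one_gsec gsec_eq_iff elim!: gsectionsE)
next
  assume nz: "\<forall>z\<in>S. f z \<noteq> 0"
  let ?b = "gsec S (\<lambda>z. inverse (f z)) (\<lambda>z. - g z * inverse (f z) * inverse (f z))"
  have "?b \<in> gsections 1 1 (pt ` S)"
    using assms nz by (auto intro!: holomorphic_intros)
  moreover have "?b \<otimes>\<^bsub>str Gsp (pt ` S)\<^esub> gsec S f g = \<one>\<^bsub>str Gsp (pt ` S)\<^esub>"
                "gsec S f g \<otimes>\<^bsub>str Gsp (pt ` S)\<^esub> ?b = \<one>\<^bsub>str Gsp (pt ` S)\<^esub>"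
    using nz by (auto simp: one_gsec gsec_eq_iff field_simps)
  ultimately show "gsec S f g \<in> Units (str Gsp (pt ` S))"
    using assms unfolding Units_def
    by (simp del: mult_gsec) (rule bexI[of _ ?b], simp_all del: mult_gsec)
qed

text \<open>By continuity \<open>f\<close> stays nonzero on an open neighbourhood of
  \<open>z\<close>, and there the section is a unit.\<close>

lemma germ_unit_gsec_iff:
  assumes "open S" "0 \<notin> S" "z \<in> S" "f holomorphic_on S" "g holomorphic_on S"
  shows "germ_unit Gsp (pt z) (pt ` S) (gsec S f g) \<longleftrightarrow> f z \<noteq> 0"
proof
  assume "germ_unit Gsp (pt z) (pt ` S) (gsec S f g)"
  then obtain S' where S': "pt z \<in> pt ` S'" "pt ` S' \<subseteq> pt ` S"
      "rest Gsp (pt ` S) (pt ` S') (gsec S f g) \<in> Units (str Gsp (pt ` S'))"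
    unfolding germ_unit_def openin_Gsp_iff by blast
  then have "S' \<subseteq> S"
    by (metis inj_image_subset_iff inj_pt)
  with S' assms gsec_in_Units_iff[of f S' g] show "f z \<noteq> 0"
    by (auto dest: holomorphic_on_subset)
next
  assume "f z \<noteq> 0"
  define S' where "S' = {u \<in> S. f u \<noteq> 0}"
  have "open S'"
    unfolding S'_def using assms continuous_open_preimage[of S f "- {0}"]
    by (auto simp: holomorphic_on_imp_continuous_on vimage_def Int_def)
  moreover have "S' \<subseteq> S" "\<forall>u\<in>S'. f u \<noteq> 0" "z \<in> S'"
    using assms \<open>f z \<noteq> 0\<close> by (auto simp: S'_def)
  ultimately show "germ_unit Gsp (pt z) (pt ` S) (gsec S f g)"
    unfolding germ_unit_def openin_Gsp_iff using assms gsec_in_Units_iff[of f S' g]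
    by (intro exI[of _ "pt ` S'"]) (auto dest: holomorphic_on_subset)
qed

lemma gen_w_gsec: "gen_w = gsec (- {0}) (\<lambda>z. z) (\<lambda>_. 0)"
  and gen_eta_gsec: "gen_eta = gsec (- {0}) (\<lambda>_. 0) (\<lambda>_. 1)"
  by (auto simp: gen_w_def gen_eta_def gsec_def Gpts_def fun_eq_iff)

section \<open>Endomorphisms\<close>

text \<open>The map \<open>(w, \<eta>) \<mapsto> (\<phi>(w), g(w) \<eta>)\<close>.\<close>

definition gmap :: "(complex \<Rightarrow> complex) \<Rightarrow> (complex \<Rightarrow> complex) \<Rightarrow> G_endo" where
  "gmap \<phi> g =
     \<lparr>body = (\<lambda>x\<in>Gpts. pt (\<phi> (x 0))),
      pull = (\<lambda>V\<in>{V. openin (pts Gsp) V}. \<lambda>a\<in>sections Gsp V. \<lambda>I x.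
        if x \<in> Gpts \<and> pt (\<phi> (x 0)) \<in> V
        then if I = {} then a {} (pt (\<phi> (x 0))) else if I = {0} then g (x 0) * a {0} (pt (\<phi> (x 0))) else 0
        else 0)\<rparr>"

text \<open>Nonvanishing of \<open>\<phi>\<close> keeps the underlying map inside the punctured
  plane. Zeros of \<open>g\<close> are allowed, since endomorphisms need not be invertible.\<close>

definition gmap_data :: "(complex \<Rightarrow> complex) \<Rightarrow> (complex \<Rightarrow> complex) \<Rightarrow> bool" where
  "gmap_data \<phi> g \<longleftrightarrow>
     \<phi> holomorphic_on - {0} \<and> g holomorphic_on - {0} \<and> (\<forall>z. z \<noteq> 0 \<longrightarrow> \<phi> z \<noteq> 0)"

lemma body_gmap: "z \<noteq> 0 \<Longrightarrow> body (gmap \<phi> g) (pt z) = pt (\<phi> z)"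
  by (simp add: gmap_def Gpts_def)

lemma preim_gmap [simp]: "preim Gsp (gmap \<phi> g) (pt ` S) = pt ` (\<phi> -` S - {0})"
  by (auto simp: preim_def gmap_def Gpts_def)

lemma pull_gmap [simp]:
  assumes "open S" "0 \<notin> S" "f holomorphic_on S" "h holomorphic_on S"
  shows "pull (gmap \<phi> g) (pt ` S) (gsec S f h) =
    gsec (\<phi> -` S - {0}) (\<lambda>z. f (\<phi> z)) (\<lambda>z. g z * h (\<phi> z))"
proof -
  have "openin (pts Gsp) (pt ` S)"
    using assms openin_Gsp_iff by blast
  then show ?thesis
    using assms gsec_in_gsections_iff[of S f h]
    by (auto simp: gmap_def gsec_def Gpts_def fun_eq_iff simp del: gsec_in_gsections_iff)
qed

text \<open>Isolates the extensionality clauses of \<open>super_morphism\<close>, so that identities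
  and composites can be compared with \<open>gmap\<close> before they are known to be
  morphisms.\<close>

definition extensional_endo :: "G_endo \<Rightarrow> bool" where
  "extensional_endo F \<longleftrightarrow>
     body F \<in> extensional Gpts \<and> pull F \<in> extensional {V. openin (pts Gsp) V} \<and>
     (\<forall>V. openin (pts Gsp) V \<longrightarrow> pull F V \<in> extensional (sections Gsp V))"

lemma extensional_endo_eqI:
  assumes "extensional_endo F" "extensional_endo F'"
    and body: "\<And>z. z \<noteq> 0 \<Longrightarrow> body F (pt z) = body F' (pt z)"
    and pull: "\<And>S f h. \<lbrakk>open S; 0 \<notin> S; f holomorphic_on S; h holomorphic_on S\<rbrakk> \<Longrightarrow>
      pull F (pt ` S) (gsec S f h) = pull F' (pt ` S) (gsec S f h)"
  shows "F = F'"
proof -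
  have "body F = body F'"
    by (rule extensionalityI[of _ Gpts]) (use assms(1,2) body in \<open>auto simp: extensional_endo_def Gpts_def\<close>)
  moreover have "pull F = pull F'"
  proof (rule extensionalityI[of _ "{V. openin (pts Gsp) V}"])
    fix V assume V: "V \<in> {V. openin (pts Gsp) V}"
    show "pull F V = pull F' V"
    proof (rule extensionalityI[of _ "sections Gsp V"])
      fix a assume "a \<in> sections Gsp V"
      moreover obtain S where "open S" "0 \<notin> S" "V = pt ` S"
        using V openin_Gsp_iff by auto
      ultimately show "pull F V a = pull F' V a"
        using pull by (auto elim!: gsectionsE)
    qed (use assms(1,2) V in \<open>auto simp: extensional_endo_def\<close>)
  qed (use assms(1,2) in \<open>auto simp: extensional_endo_def\<close>)
  ultimately show ?thesis
    by simp
qed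

lemma extensional_endo_gmap: "extensional_endo (gmap \<phi> g)"
  by (auto simp: extensional_endo_def gmap_def)

lemma holomorphic_on_compose_vimage:
  assumes "gmap_data \<phi> g" "f holomorphic_on S"
  shows "(\<lambda>z. f (\<phi> z)) holomorphic_on (\<phi> -` S - {0})"
proof -
  have "f \<circ> \<phi> holomorphic_on (\<phi> -` S - {0})"
    by (rule holomorphic_on_compose_gen[of _ _ _ S])
       (use assms in \<open>auto simp: gmap_data_def intro: holomorphic_on_subset\<close>)
  then show ?thesis
    by (simp add: comp_def)
qed

lemma open_vimage_gmap:
  assumes "gmap_data \<phi> g" "open S"
  shows "open (\<phi> -` S - {0})"
proof -
  have "open (- {0} \<inter> \<phi> -` S)"
    by (rule continuous_open_preimage)
       (use assms in \<open>auto simp: gmap_data_def intro: holomorphic_on_imp_continuous_on\<close>)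
  then show ?thesis
    by (simp add: Diff_eq Int_commute)
qed

text \<open>In normal form every clause is a pointwise identity or a closure property of holomorphic
  functions. Locality holds because germ units are detected by the even coefficient, which at
  \<open>z\<close> is \<open>f (\<phi> z)\<close>.\<close>

lemma super_morphism_gmap:
  assumes d: "gmap_data \<phi> g"
  shows "super_morphism Gsp Gsp (gmap \<phi> g)"
proof -
  let ?F = "gmap \<phi> g"
  have g: "g holomorphic_on (\<phi> -` S - {0})" for S
    using d by (auto simp: gmap_data_def intro: holomorphic_on_subset)
  note hol = holomorphic_on_compose_vimage[OF d]
  have "continuous_map (pts Gsp) (pts Gsp) (body ?F)"
    unfolding continuous_map_def
  proof (intro conjI allI impI)
    show "body ?F \<in> topspace (pts Gsp) \<rightarrow> topspace (pts Gsp)"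
      using d by (auto simp: gmap_def Gpts_def gmap_data_def)
    fix V assume "openin (pts Gsp) V"
    then obtain S where "open S" "V = pt ` S"
      using openin_Gsp_iff by auto
    then have "openin (pts Gsp) (preim Gsp ?F V)"
      using open_vimage_gmap[OF d] by (auto simp: openin_Gsp_iff)
    then show "openin (pts Gsp) {x \<in> topspace (pts Gsp). body ?F x \<in> V}"
      by (simp add: preim_def)
  qed
  moreover have "super_hom (str Gsp V) (grade Gsp V) (str Gsp (preim Gsp ?F V)) (grade Gsp (preim Gsp ?F V)) (pull ?F V)"
    if V: "openin (pts Gsp) V" for V
  proof -
    obtain S where S: "open S" "0 \<notin> S" "V = pt ` S"
      using V openin_Gsp_iff by auto
    have grade: "a \<in> sections Gsp V" if "a \<in> grade Gsp V i" for a i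
      using that by (auto simp: grade_Gsp cspace_super_def)
    have "pull ?F V \<in> ring_hom (str Gsp V) (str Gsp (preim Gsp ?F V))"
    proof (rule ring_hom_memI)
      fix a assume "a \<in> sections Gsp V"
      then show "pull ?F V a \<in> sections Gsp (preim Gsp ?F V)"
        using S g hol by (auto elim!: gsectionsE intro!: holomorphic_on_mult)
    next
      fix a b assume "a \<in> sections Gsp V" "b \<in> sections Gsp V"
      then show "pull ?F V (a \<otimes>\<^bsub>str Gsp V\<^esub> b) =
          pull ?F V a \<otimes>\<^bsub>str Gsp (preim Gsp ?F V)\<^esub> pull ?F V b"
        "pull ?F V (a \<oplus>\<^bsub>str Gsp V\<^esub> b) =
          pull ?F V a \<oplus>\<^bsub>str Gsp (preim Gsp ?F V)\<^esub> pull ?F V b"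
        using S by (auto elim!: gsectionsE simp: gsec_eq_iff algebra_simps
              holomorphic_on_mult holomorphic_on_add)
    next
      show "pull ?F V \<one>\<^bsub>str Gsp V\<^esub> = \<one>\<^bsub>str Gsp (preim Gsp ?F V)\<^esub>"
        using S by (simp add: one_gsec)
    qed
    moreover have "pull ?F V (c \<odot>\<^bsub>str Gsp V\<^esub> a) = c \<odot>\<^bsub>str Gsp (preim Gsp ?F V)\<^esub> pull ?F V a"
      if "a \<in> sections Gsp V" for c a
      using that S by (auto elim!: gsectionsE simp: gsec_eq_iff holomorphic_on_mult)
    moreover have "pull ?F V a \<in> grade Gsp (preim Gsp ?F V) i" if a: "a \<in> grade Gsp V i" for a i
    proof -
      obtain f h where "a = gsec S f h"
        using grade[OF a] S by (auto elim!: gsectionsE)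
      then show ?thesis
        using a S g hol by (cases i) (auto simp: gsec_in_grade_iff intro!: holomorphic_on_mult)
    qed
    ultimately show ?thesis
      unfolding super_hom_def by auto
  qed
  moreover have "rest Gsp (preim Gsp ?F V) (preim Gsp ?F W) (pull ?F V a) = pull ?F W (rest Gsp V W a)"
    if VW: "openin (pts Gsp) V" "openin (pts Gsp) W" "W \<subseteq> V" and a: "a \<in> sections Gsp V" for V W a
  proof -
    obtain S S' where S: "open S" "0 \<notin> S" "V = pt ` S" "open S'" "0 \<notin> S'" "W = pt ` S'"
      using VW openin_Gsp_iff by auto
    with VW(3) have "S' \<subseteq> S"
      by (metis inj_image_subset_iff inj_pt)
    moreover from this have "\<phi> -` S' - {0} \<subseteq> \<phi> -` S - {0}"
      by blast
    moreover obtain f h where "f holomorphic_on S" "h holomorphic_on S" "a = gsec S f h"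
      using a S by (auto elim!: gsectionsE)
    ultimately show ?thesis
      using S by (simp add: holomorphic_on_subset[of _ S])
  qed
  moreover have "germ_unit Gsp (body ?F x) V a"
    if V: "openin (pts Gsp) V" and x: "x \<in> preim Gsp ?F V" and a: "a \<in> sections Gsp V"
      and u: "germ_unit Gsp x (preim Gsp ?F V) (pull ?F V a)" for V x a
  proof -
    obtain S where S: "open S" "0 \<notin> S" "V = pt ` S"
      using V openin_Gsp_iff by auto
    moreover obtain f h where fh: "f holomorphic_on S" "h holomorphic_on S" "a = gsec S f h"
      using a S by (auto elim!: gsectionsE)
    moreover obtain z where z: "z \<noteq> 0" "\<phi> z \<in> S" "x = pt z"
      using x S by auto
    ultimately have "germ_unit Gsp (pt z) (pt ` (\<phi> -` S - {0})) (gsec (\<phi> -` S - {0}) (\<lambda>z. f (\<phi> z)) (\<lambda>z. g z * h (\<phi> z)))"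
      using u by simp
    then have "f (\<phi> z) \<noteq> 0"
      using open_vimage_gmap[OF d S(1)] hol[OF fh(1)] holomorphic_on_mult[OF g hol[OF fh(2)]] z
      by (simp add: germ_unit_gsec_iff)
    then show ?thesis
      using S fh z by (simp add: body_gmap germ_unit_gsec_iff)
  qed
  ultimately show ?thesis
    unfolding super_morphism_def using extensional_endo_gmap[of \<phi> g] by (simp add: extensional_endo_def)
qed

lemma Gpts_alt: "Gpts = pt ` (- {0})"
  by (simp add: Gpts_def)

lemma coord_gmap [simp]:
  assumes "gmap_data \<phi> g"
  shows "coord_w (gmap \<phi> g) = gsec (- {0}) \<phi> (\<lambda>_. 0)"
    and "coord_eta (gmap \<phi> g) = gsec (- {0}) (\<lambda>_. 0) g"
proof -
  have "\<phi> -` (- {0}) - {0} = - {0}"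
    using assms by (auto simp: gmap_data_def)
  then show "coord_w (gmap \<phi> g) = gsec (- {0}) \<phi> (\<lambda>_. 0)"
    and "coord_eta (gmap \<phi> g) = gsec (- {0}) (\<lambda>_. 0) g"
    unfolding Gpts_alt gen_w_gsec gen_eta_gsec by (simp_all add: open_nonzero holomorphic_on_id)
qed

text \<open>\<open>\<phi>\<close> and \<open>g\<close> are total functions, but \<open>gmap\<close>
  evaluates them on the punctured plane only.\<close>

lemma gmap_cong:
  assumes "\<And>z. z \<noteq> 0 \<Longrightarrow> \<phi> z = \<phi>' z" "\<And>z. z \<noteq> 0 \<Longrightarrow> g z = g' z"
  shows "gmap \<phi> g = gmap \<phi>' g'"
proof (rule extensional_endo_eqI[OF extensional_endo_gmap extensional_endo_gmap])
  fix S :: "complex set" and f h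
  assume S: "open S" "0 \<notin> S" "f holomorphic_on S" "h holomorphic_on S"
  have "\<phi> -` S - {0} = \<phi>' -` S - {0}"
    using assms by auto
  then show "pull (gmap \<phi> g) (pt ` S) (gsec S f h) = pull (gmap \<phi>' g') (pt ` S) (gsec S f h)"
    using S assms by (simp add: gsec_eq_iff)
qed (simp add: body_gmap assms)

lemma super_id_Gsp: "super_id Gsp = gmap (\<lambda>z. z) (\<lambda>_. 1)"
proof (rule extensional_endo_eqI[OF _ extensional_endo_gmap])
  show "body (super_id Gsp) (pt z) = body (gmap (\<lambda>z. z) (\<lambda>_. 1)) (pt z)" if "z \<noteq> 0" for z
    using that body_gmap[of z "\<lambda>z. z"] by (auto simp: super_id_def Gpts_def)
  fix S :: "complex set" and f h
  assume S: "open S" "0 \<notin> S" "f holomorphic_on S" "h holomorphic_on S"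
  then have "openin (pts Gsp) (pt ` S)"
    using openin_Gsp_iff by blast
  then show "pull (super_id Gsp) (pt ` S) (gsec S f h) =
      pull (gmap (\<lambda>z. z) (\<lambda>_. 1)) (pt ` S) (gsec S f h)"
    using S by (simp add: super_id_def)
qed (auto simp: super_id_def extensional_endo_def)

text \<open>The second map pulls \<open>\<eta>\<close> back to \<open>g' \<eta>\<close>; the first
  then turns \<open>g'\<close> into \<open>g' (\<phi> z)\<close> and \<open>\<eta>\<close> into
  \<open>g \<eta>\<close>.\<close>

lemma super_comp_gmap:
  assumes d: "gmap_data \<phi> g" and d': "gmap_data \<phi>' g'"
  shows "super_comp Gsp Gsp Gsp (gmap \<phi>' g') (gmap \<phi> g) =
    gmap (\<lambda>z. \<phi>' (\<phi> z)) (\<lambda>z. g z * g' (\<phi> z))"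
proof (rule extensional_endo_eqI[OF _ extensional_endo_gmap])
  show "body (super_comp Gsp Gsp Gsp (gmap \<phi>' g') (gmap \<phi> g)) (pt z) =
      body (gmap (\<lambda>z. \<phi>' (\<phi> z)) (\<lambda>z. g z * g' (\<phi> z))) (pt z)" if "z \<noteq> 0" for z
    using d that by (simp add: super_comp_def body_gmap gmap_data_def Gpts_alt)
  fix S :: "complex set" and f h
  assume S: "open S" "0 \<notin> S" and fh: "f holomorphic_on S" "h holomorphic_on S"
  then have V: "openin (pts Gsp) (pt ` S)"
    using openin_Gsp_iff by blast
  have "g' holomorphic_on (\<phi>' -` S - {0})"
    using d' by (auto simp: gmap_data_def intro: holomorphic_on_subset)
  then have "(\<lambda>z. g' z * h (\<phi>' z)) holomorphic_on (\<phi>' -` S - {0})"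
    using holomorphic_on_compose_vimage[OF d' fh(2)] by (rule holomorphic_on_mult)
  moreover have "\<phi> -` (\<phi>' -` S - {0}) - {0} = (\<lambda>z. \<phi>' (\<phi> z)) -` S - {0}"
    using d by (auto simp: gmap_data_def)
  ultimately show "pull (super_comp Gsp Gsp Gsp (gmap \<phi>' g') (gmap \<phi> g)) (pt ` S) (gsec S f h) =
      pull (gmap (\<lambda>z. \<phi>' (\<phi> z)) (\<lambda>z. g z * g' (\<phi> z))) (pt ` S) (gsec S f h)"
    using V S fh open_vimage_gmap[OF d' S(1)] holomorphic_on_compose_vimage[OF d' fh(1)]
    by (simp add: super_comp_def gsec_eq_iff mult.assoc)
qed (auto simp: super_comp_def extensional_endo_def)

section \<open>Classification of the endomorphisms\<close>

lemma gsec_evenE: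
  assumes "a \<in> grade Gsp (pt ` S) False"
  obtains f where "f holomorphic_on S" "a = gsec S f (\<lambda>_. 0)"
proof -
  have "a \<in> gsections 1 1 (pt ` S)"
    using assms by (simp add: grade_Gsp cspace_super_def)
  then obtain f g where "f holomorphic_on S" "a = gsec S f g"
    by (rule gsectionsE)
  then show ?thesis
    using that assms by (auto simp: gsec_in_grade_iff gsec_eq_iff)
qed

lemma gsec_oddE:
  assumes "a \<in> grade Gsp (pt ` S) True"
  obtains g where "g holomorphic_on S" "a = gsec S (\<lambda>_. 0) g"
proof -
  have "a \<in> gsections 1 1 (pt ` S)"
    using assms by (simp add: grade_Gsp cspace_super_def)
  then obtain f g where "g holomorphic_on S" "a = gsec S f g"
    by (rule gsectionsE)
  then show ?thesis
    using that assms by (auto simp: gsec_in_grade_iff gsec_eq_iff)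
qed

text \<open>Locality of the maps of stalks: \<open>a - f u\<close> is not a unit at \<open>u\<close>, hence its pullback
  \<open>F\<^sup>* a - f u\<close> is not a unit at \<open>z\<close>.\<close>

lemma pull_eval:
  assumes F: "super_morphism Gsp Gsp F"
    and S: "open S" "0 \<notin> S" "f holomorphic_on S" "h holomorphic_on S"
    and S': "open S'" "0 \<notin> S'" "f' holomorphic_on S'" "h' holomorphic_on S'"
    and preim: "preim Gsp F (pt ` S) = pt ` S'"
    and pull: "pull F (pt ` S) (gsec S f h) = gsec S' f' h'"
    and z: "z \<in> S'" and u: "body F (pt z) = pt u"
  shows "f' z = f u"
proof (rule ccontr)
  assume ne: "f' z \<noteq> f u"
  have V: "openin (pts Gsp) (pt ` S)"
    using S openin_Gsp_iff by blast
  have hom: "pull F (pt ` S) \<in> ring_hom (str Gsp (pt ` S)) (str Gsp (pt ` S'))"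
    and smult: "\<And>c a. a \<in> sections Gsp (pt ` S) \<Longrightarrow> pull F (pt ` S) (c \<odot>\<^bsub>str Gsp (pt ` S)\<^esub> a) =
        c \<odot>\<^bsub>str Gsp (pt ` S')\<^esub> pull F (pt ` S) a"
    using F V preim unfolding super_morphism_def super_hom_def by auto
  have one: "gsec S (\<lambda>_. 1) (\<lambda>_. 0) \<in> sections Gsp (pt ` S)"
    by simp
  \<comment> \<open>Subtracting the constant is phrased through the unit section, so that linearity
    and the ring homomorphism laws compute the pullback.\<close>
  have b_eq: "gsec S (\<lambda>z. f z - f u) h = gsec S f h \<oplus>\<^bsub>str Gsp (pt ` S)\<^esub> (- f u) \<odot>\<^bsub>str Gsp (pt ` S)\<^esub> gsec S (\<lambda>_. 1) (\<lambda>_. 0)"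
    by simp
  have "pull F (pt ` S) (gsec S (\<lambda>_. 1) (\<lambda>_. 0)) = gsec S' (\<lambda>_. 1) (\<lambda>_. 0)"
    using ring_hom_one[OF hom] by (simp add: one_gsec)
  then have "pull F (pt ` S) ((- f u) \<odot>\<^bsub>str Gsp (pt ` S)\<^esub> gsec S (\<lambda>_. 1) (\<lambda>_. 0)) = gsec S' (\<lambda>_. - f u) (\<lambda>_. 0)"
    using smult[OF one] by simp
  then have "pull F (pt ` S) (gsec S (\<lambda>z. f z - f u) h) = gsec S' (\<lambda>z. f' z - f u) h'"
    unfolding b_eq using ring_hom_add[OF hom, of "gsec S f h" "(- f u) \<odot>\<^bsub>str Gsp (pt ` S)\<^esub> gsec S (\<lambda>_. 1) (\<lambda>_. 0)"] pull S
    by simp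
  moreover have "germ_unit Gsp (pt z) (pt ` S') (gsec S' (\<lambda>z. f' z - f u) h')"
    using ne S' z by (subst germ_unit_gsec_iff) (auto intro!: holomorphic_intros)
  moreover have "gsec S (\<lambda>z. f z - f u) h \<in> sections Gsp (pt ` S)"
    using S by (auto intro!: holomorphic_intros)
  ultimately have "germ_unit Gsp (pt u) (pt ` S) (gsec S (\<lambda>z. f z - f u) h)"
    using F V preim z u unfolding super_morphism_def by (metis pt_in_image_iff)
  moreover have "u \<in> S"
    using z preim u by (metis (no_types, lifting) mem_Collect_eq preim_def pt_in_image_iff)
  ultimately show False
    using S germ_unit_gsec_iff[of S u "\<lambda>z. f z - f u" h] holomorphic_on_diff[OF S(3) holomorphic_on_const]
    by simp
qed

text \<open>\<open>\<phi>\<close> and \<open>g\<close> are read off from the two pulled back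
  coordinates; the pullbacks of functions, of \<open>\<eta>\<close>, and then of
  \<open>f + h \<eta>\<close> over every open set are forced.\<close>

lemma super_morphism_Gsp_cases:
  assumes F: "super_morphism Gsp Gsp F"
  obtains \<phi> g where "gmap_data \<phi> g" "F = gmap \<phi> g"
proof -
  have cont: "continuous_map (pts Gsp) (pts Gsp) (body F)"
    using F by (simp add: super_morphism_def)
  have homs: "super_hom (str Gsp V) (grade Gsp V) (str Gsp (preim Gsp F V)) (grade Gsp (preim Gsp F V)) (pull F V)"
    if "openin (pts Gsp) V" for V
    using F that by (simp add: super_morphism_def)
  have preim_Gpts: "preim Gsp F Gpts = Gpts"
    using continuous_map_image_subset_topspace[OF cont] by (auto simp: preim_def)
  have w_mem: "gen_w \<in> grade Gsp Gpts False" and eta_mem: "gen_eta \<in> grade Gsp Gpts True"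
    by (auto simp: gen_w_gsec gen_eta_gsec Gpts_alt gsec_in_grade_iff)
  have "coord_w F \<in> grade Gsp (pt ` (- {0})) False" "coord_eta F \<in> grade Gsp (pt ` (- {0})) True"
    using homs[of Gpts] w_mem eta_mem unfolding super_hom_def preim_Gpts Gpts_alt[symmetric]
    by (simp_all add: image_subset_iff)
  then obtain \<phi> g where \<phi>: "\<phi> holomorphic_on - {0}" "coord_w F = gsec (- {0}) \<phi> (\<lambda>_. 0)"
    and g: "g holomorphic_on - {0}" "coord_eta F = gsec (- {0}) (\<lambda>_. 0) g"
    by (metis gsec_evenE gsec_oddE)
  have body: "body F (pt z) = pt (\<phi> z) \<and> \<phi> z \<noteq> 0" if z: "z \<noteq> 0" for z
  proof -
    have "body F (pt z) \<in> Gpts"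
      using continuous_map_image_subset_topspace[OF cont] z by (auto simp: Gpts_def)
    then obtain u where u: "u \<noteq> 0" "body F (pt z) = pt u"
      by (auto simp: Gpts_def)
    \<comment> \<open>Evaluating the coordinate \<open>w\<close> itself shows that its pullback is
      the underlying map.\<close>
    have "\<phi> z = u"
      by (rule pull_eval[OF F, of "- {0}" "\<lambda>z. z" "\<lambda>_. 0" "- {0}" \<phi> "\<lambda>_. 0"])
         (use \<phi> z u preim_Gpts open_nonzero in \<open>simp_all add: Gpts_alt gen_w_gsec\<close>)
    with u show ?thesis
      by simp
  qed
  have data: "gmap_data \<phi> g"
    using \<phi> g body by (simp add: gmap_data_def)
  have preim: "preim Gsp F (pt ` S) = pt ` (\<phi> -` S - {0})" for S
    using body by (auto simp: preim_def Gpts_def)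
  have "F = gmap \<phi> g"
  proof (rule extensional_endo_eqI[OF _ extensional_endo_gmap])
    show "extensional_endo F"
      using F by (simp add: super_morphism_def extensional_endo_def)
    show "body F (pt z) = body (gmap \<phi> g) (pt z)" if "z \<noteq> 0" for z
      using body that by (simp add: body_gmap)
    fix S :: "complex set" and f h
    assume S: "open S" "0 \<notin> S" "f holomorphic_on S" "h holomorphic_on S"
    let ?S' = "\<phi> -` S - {0}"
    have S': "open ?S'" "0 \<notin> ?S'"
      using open_vimage_gmap[OF data S(1)] by auto
    have V: "openin (pts Gsp) (pt ` S)"
      using S openin_Gsp_iff by blast
    have hom: "pull F (pt ` S) \<in> ring_hom (str Gsp (pt ` S)) (str Gsp (pt ` ?S'))"
      and grade: "\<And>i a. a \<in> grade Gsp (pt ` S) i \<Longrightarrow> pull F (pt ` S) a \<in> grade Gsp (pt ` ?S') i"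
      using homs[OF V] unfolding super_hom_def preim by (simp_all add: image_subset_iff)
    \<comment> \<open>The grading makes the pullback a function again, and \<open>pull_eval\<close>
      fixes its value at every point.\<close>
    have even: "pull F (pt ` S) (gsec S f (\<lambda>_. 0)) = gsec ?S' (\<lambda>z. f (\<phi> z)) (\<lambda>_. 0)"
      if f: "f holomorphic_on S" for f
    proof -
      have "gsec S f (\<lambda>_. 0) \<in> grade Gsp (pt ` S) False"
        using f by (simp add: gsec_in_grade_iff)
      from grade[OF this] obtain f' where f': "f' holomorphic_on ?S'"
        "pull F (pt ` S) (gsec S f (\<lambda>_. 0)) = gsec ?S' f' (\<lambda>_. 0)"
        by (rule gsec_evenE)
      have "f' z = f (\<phi> z)" if z: "z \<in> ?S'" for z
        using pull_eval[OF F S(1,2) f _ S' f'(1) _ preim f'(2) z] body z by simp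
      with f' show ?thesis
        by (simp add: gsec_eq_iff)
    qed
    \<comment> \<open>Over \<open>S\<close> the generator is the restriction of the global
      \<open>\<eta>\<close>, so compatibility with restriction reduces to
      \<open>coord_eta F\<close>.\<close>
    have eta: "pull F (pt ` S) (gsec S (\<lambda>_. 0) (\<lambda>_. 1)) = gsec ?S' (\<lambda>_. 0) g"
    proof -
      have sub: "S \<subseteq> - {0}" "?S' \<subseteq> - {0}"
        using S by auto
      have "pt ` S \<subseteq> Gpts"
        using sub by (auto simp: Gpts_def)
      moreover have "gen_eta \<in> sections Gsp Gpts"
        by (simp add: Gpts_alt gen_eta_gsec)
      ultimately have "rest Gsp (preim Gsp F Gpts) (preim Gsp F (pt ` S)) (coord_eta F) =
          pull F (pt ` S) (rest Gsp Gpts (pt ` S) gen_eta)"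
        using F V unfolding super_morphism_def by (metis openin_Gsp_Gpts)
      then show ?thesis
        using g(2) sub by (simp add: preim preim_Gpts gen_eta_gsec)
    qed
    have "pull F (pt ` S) (gsec S f h) = pull F (pt ` S) (gsec S f (\<lambda>_. 0)) \<oplus>\<^bsub>str Gsp (pt ` ?S')\<^esub>
        pull F (pt ` S) (gsec S h (\<lambda>_. 0)) \<otimes>\<^bsub>str Gsp (pt ` ?S')\<^esub> pull F (pt ` S) (gsec S (\<lambda>_. 0) (\<lambda>_. 1))"
      using S ring_hom_mult[OF hom, of "gsec S h (\<lambda>_. 0)" "gsec S (\<lambda>_. 0) (\<lambda>_. 1)"]
        ring_hom_add[OF hom, of "gsec S f (\<lambda>_. 0)" "gsec S (\<lambda>_. 0) h"] by simp
    also have "\<dots> = gsec ?S' (\<lambda>z. f (\<phi> z)) (\<lambda>z. g z * h (\<phi> z))"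
      unfolding even[OF S(3)] even[OF S(4)] eta by (simp add: gsec_eq_iff)
    finally show "pull F (pt ` S) (gsec S f h) = pull (gmap \<phi> g) (pt ` S) (gsec S f h)"
      using S by simp
  qed
  with data show ?thesis
    by (rule that)
qed

section \<open>The inversion maps\<close>

lemma holomorphic_on_inverse_nonzero: "inverse holomorphic_on - {0 :: complex}"
  using holomorphic_on_inverse[OF holomorphic_on_id, of "- {0}"] by (simp add: id_def)

lemma inv_gen_w: "inv\<^bsub>OG\<^esub> gen_w = gsec (- {0}) inverse (\<lambda>_. 0)"
proof (rule monoid.inv_char)
  show "Group.monoid OG"
    unfolding Gpts_alt by (rule monoid_str_Gsp)
  show "gen_w \<in> carrier OG" "gsec (- {0}) inverse (\<lambda>_. 0) \<in> carrier OG"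
    unfolding Gpts_alt by (simp_all add: gen_w_gsec holomorphic_on_inverse_nonzero)
  show "gen_w \<otimes>\<^bsub>OG\<^esub> gsec (- {0}) inverse (\<lambda>_. 0) = \<one>\<^bsub>OG\<^esub>"
    "gsec (- {0}) inverse (\<lambda>_. 0) \<otimes>\<^bsub>OG\<^esub> gen_w = \<one>\<^bsub>OG\<^esub>"
    unfolding Gpts_alt by (simp_all add: gen_w_gsec one_gsec gsec_eq_iff)
qed

lemma nat_pow_2:
  assumes "Group.monoid M" "x \<in> carrier M"
  shows "x [^]\<^bsub>M\<^esub> (2::nat) = x \<otimes>\<^bsub>M\<^esub> x"
proof -
  interpret Group.monoid M by fact
  show ?thesis
    using assms(2) by (simp add: numeral_2_eq_2)
qed

lemma inversion_coord_eta:
  "c \<odot>\<^bsub>OG\<^esub> ((inv\<^bsub>OG\<^esub> gen_w [^]\<^bsub>OG\<^esub> (2::nat)) \<otimes>\<^bsub>OG\<^esub> gen_eta) =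
    gsec (- {0}) (\<lambda>_. 0) (\<lambda>z. c * inverse z ^ 2)"
proof -
  have "Group.monoid OG" "gsec (- {0}) inverse (\<lambda>_. 0) \<in> carrier OG"
    unfolding Gpts_alt by (simp_all add: monoid_str_Gsp holomorphic_on_inverse_nonzero)
  then show ?thesis
    by (simp add: inv_gen_w nat_pow_2 gen_eta_gsec gsec_eq_iff power2_eq_square)
qed

lemma gmap_data_inverse: "gmap_data inverse (\<lambda>z. c * inverse z ^ 2)"
  unfolding gmap_data_def using holomorphic_on_inverse_nonzero
  by (simp add: holomorphic_on_mult holomorphic_on_power)

text \<open>Justifies the description by \<open>THE\<close>: \<open>super_morphism_gmap\<close>
  gives existence, and the classification gives uniqueness because the coordinates determine
  \<open>\<phi>\<close> and \<open>g\<close> off \<open>0\<close>.\<close>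

lemma inversion_eq: "inversion c = gmap inverse (\<lambda>z. c * inverse z ^ 2)"
  unfolding inversion_def inversion_coord_eta
proof (rule the_equality)
  let ?F = "gmap inverse (\<lambda>z. c * inverse z ^ 2)"
  show "super_morphism Gsp Gsp ?F \<and> coord_w ?F = inv\<^bsub>OG\<^esub> gen_w \<and>
      coord_eta ?F = gsec (- {0}) (\<lambda>_. 0) (\<lambda>z. c * inverse z ^ 2)"
    by (simp add: super_morphism_gmap[OF gmap_data_inverse] coord_gmap[OF gmap_data_inverse] inv_gen_w)
  fix F assume F: "super_morphism Gsp Gsp F \<and> coord_w F = inv\<^bsub>OG\<^esub> gen_w \<and>
      coord_eta F = gsec (- {0}) (\<lambda>_. 0) (\<lambda>z. c * inverse z ^ 2)"
  then have "super_morphism Gsp Gsp F"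
    by blast
  then obtain \<phi> g where "gmap_data \<phi> g" "F = gmap \<phi> g"
    by (rule super_morphism_Gsp_cases)
  with F show "F = ?F"
    by (auto simp: inv_gen_w gsec_eq_iff intro!: gmap_cong)
qed

lemma super_morphism_inversion: "super_morphism Gsp Gsp (inversion c)"
  unfolding inversion_eq by (rule super_morphism_gmap[OF gmap_data_inverse])

text \<open>In the composite for parameters \<open>a\<close> and \<open>b\<close> the powers of
  \<open>z\<close> cancel and \<open>\<eta>\<close> is scaled by \<open>a * b\<close>; so the
  inverse has parameter \<open>1 / c\<close>.\<close>

lemma super_iso_inversion:
  assumes "c \<noteq> 0"
  shows "super_iso Gsp Gsp (inversion c)"
proof -
  have "super_comp Gsp Gsp Gsp (inversion b) (inversion a) = super_id Gsp" if "a * b = 1" for a b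
  proof -
    have "a * inverse z ^ 2 * (b * inverse (inverse z) ^ 2) = 1" if "z \<noteq> 0" for z
      using that \<open>a * b = 1\<close> by (simp add: field_simps)
    then show ?thesis
      unfolding inversion_eq super_comp_gmap[OF gmap_data_inverse gmap_data_inverse] super_id_Gsp
      by (intro gmap_cong) auto
  qed
  from this[of c "1 / c"] this[of "1 / c" c] show ?thesis
    unfolding super_iso_def using assms super_morphism_inversion
    by (intro conjI exI[of _ "inversion (1 / c)"]) simp_all
qed

section \<open>The SUSY-1 structure\<close>

text \<open>Coefficients are extended by \<open>0\<close> at the puncture, but near
  \<open>z \<noteq> 0\<close> they agree with \<open>f\<close> and \<open>g\<close>, and derivatives
  are local.\<close>

lemma partial_w_gsec: "partial_w (gsec (- {0}) f g) = gsec (- {0}) (deriv f) (deriv g)"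
proof (intro ext)
  fix I x
  show "partial_w (gsec (- {0}) f g) I x = gsec (- {0}) (deriv f) (deriv g) I x"
  proof (cases "x \<in> pt ` (- {0})")
    case True
    then obtain z where z: "z \<noteq> 0" "x = pt z"
      by auto
    have ev: "\<forall>\<^sub>F u in nhds z. u \<noteq> 0"
      using z by (intro t1_space_nhds) auto
    have "deriv (\<lambda>u. gsec (- {0}) f g I (pt u)) z =
        deriv (if I = {} then f else if I = {0} then g else (\<lambda>_. 0)) z"
      by (rule deriv_cong_ev[OF eventually_mono[OF ev]]) (auto simp: gsec_def)
    also have "\<dots> = gsec (- {0}) (deriv f) (deriv g) I x"
      using z by (simp add: gsec_def)
    finally show ?thesis
      using z by (simp add: partial_w_def Gpts_alt)
  next
    case False
    then show ?thesis
      by (simp add: partial_w_def gsec_def Gpts_alt)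
  qed
qed

lemma partial_eta_gsec: "partial_eta (gsec S f g) = gsec S g (\<lambda>_. 0)"
  by (auto simp: partial_eta_def gsec_def fun_eq_iff)

text \<open>The part \<open>g' \<eta> dw\<close> of \<open>d(g \<eta>)\<close> gets multiplied by
  \<open>- k g \<eta>\<close> and dies with \<open>\<eta>^2 = 0\<close>, so no derivative of
  \<open>g\<close> survives.\<close>

lemma form_pull_susy_form:
  assumes d: "gmap_data \<phi> g"
  shows "form_pull (gmap \<phi> g) (susy_form k) =
    (gsec (- {0}) (\<lambda>z. \<phi> z * deriv \<phi> z) (\<lambda>_. 0), gsec (- {0}) (\<lambda>_. 0) (\<lambda>z. - k * g z ^ 2))"
proof -
  have "pull (gmap \<phi> g) Gpts ((- k) \<odot>\<^bsub>OG\<^esub> gen_eta) = gsec (- {0}) (\<lambda>_. 0) (\<lambda>z. - k * g z)"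
  proof -
    have "\<phi> -` (- {0}) - {0} = - {0}"
      using d by (auto simp: gmap_data_def)
    then show ?thesis
      unfolding Gpts_alt gen_eta_gsec using open_nonzero by (simp add: gsec_eq_iff)
  qed
  then show ?thesis
    using d by (simp add: form_pull_def susy_form_def ext_d_def form_add_def form_mult_def
        partial_w_gsec partial_eta_gsec gsec_eq_iff power2_eq_square)
qed

text \<open>An even \<open>h\<close> is a function \<open>f\<close>. As \<open>k \<noteq> 0\<close>,
  the \<open>d\<eta>\<close> coefficients give \<open>f = g^2\<close>, whence the \<open>dw\<close>
  coefficients give the equation; invertibility of \<open>h\<close> says that \<open>g\<close> has
  no zeros.\<close>

lemma preserves_susy_gmap_iff:
  assumes d: "gmap_data \<phi> g" and k: "k \<noteq> 0"
  shows "preserves_susy k (gmap \<phi> g) \<longleftrightarrow> (\<forall>z. z \<noteq> 0 \<longrightarrow> g z \<noteq> 0 \<and> \<phi> z * deriv \<phi> z = g z ^ 2 * z)"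
proof
  assume "preserves_susy k (gmap \<phi> g)"
  then obtain h where h: "h \<in> grade Gsp (pt ` (- {0})) False" "h \<in> Units (str Gsp (pt ` (- {0})))"
    and eq: "form_pull (gmap \<phi> g) (susy_form k) = form_mult h (susy_form k)"
    by (auto simp: preserves_susy_def Gpts_alt)
  from h(1) obtain f where f: "f holomorphic_on - {0}" "h = gsec (- {0}) f (\<lambda>_. 0)"
    by (rule gsec_evenE)
  then have "\<forall>z\<in>- {0}. f z \<noteq> 0"
    using h(2) gsec_in_Units_iff[of f "- {0}" "\<lambda>_. 0"] by simp
  moreover have "\<phi> z * deriv \<phi> z = f z * z" "g z ^ 2 = f z" if "z \<noteq> 0" for z
    using eq k that unfolding form_pull_susy_form[OF d] f
    by (simp_all add: susy_form_def form_mult_def gen_w_gsec gen_eta_gsec gsec_eq_iff)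
  ultimately show "\<forall>z. z \<noteq> 0 \<longrightarrow> g z \<noteq> 0 \<and> \<phi> z * deriv \<phi> z = g z ^ 2 * z"
    by force
next
  assume R: "\<forall>z. z \<noteq> 0 \<longrightarrow> g z \<noteq> 0 \<and> \<phi> z * deriv \<phi> z = g z ^ 2 * z"
  let ?h = "gsec (- {0}) (\<lambda>z. g z ^ 2) (\<lambda>_. 0)"
  have g2: "(\<lambda>z. g z ^ 2) holomorphic_on - {0}"
    using d by (auto simp: gmap_data_def intro!: holomorphic_intros)
  then have "?h \<in> grade Gsp Gpts False \<inter> Units OG"
    using R unfolding Gpts_alt by (simp add: gsec_in_grade_iff gsec_in_Units_iff)
  moreover have "form_pull (gmap \<phi> g) (susy_form k) = form_mult ?h (susy_form k)"
    unfolding form_pull_susy_form[OF d] using R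
    by (simp add: susy_form_def form_mult_def gen_w_gsec gen_eta_gsec gsec_eq_iff)
  ultimately show "preserves_susy k (gmap \<phi> g)"
    unfolding preserves_susy_def by blast
qed

section \<open>SUSY-1 preserving endomorphisms over the inversion\<close>

lemma deriv_inverse:
  assumes "z \<noteq> 0"
  shows "deriv inverse z = - (inverse (z :: complex) ^ 2)"
  using DERIV_inverse[OF assms, of UNIV] unfolding numeral_2_eq_2 by (rule DERIV_imp_deriv)

lemma square_eq_neg_one_iff: "(c :: complex) ^ 2 = - 1 \<longleftrightarrow> c = \<i> \<or> c = - \<i>"
  using power2_eq_iff[of c \<i>] by simp

lemma susy_inverting_endomorphisms:
  assumes k: "k \<noteq> 0"
  shows "{F. super_morphism Gsp Gsp F \<and> preserves_susy k F \<and>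
      (\<forall>z. z \<noteq> 0 \<longrightarrow> body F (pt z) = pt (inverse z))} = {P_plus, P_minus}"
proof (intro equalityI subsetI)
  fix F assume "F \<in> {P_plus, P_minus}"
  then obtain c where c: "F = inversion c" "c ^ 2 = - 1"
    by (auto simp: P_plus_def P_minus_def)
  then have "c \<noteq> 0"
    by auto
  \<comment> \<open>The left side of the equation is minus the inverse cube of \<open>z\<close>, the
    right side \<open>c ^ 2\<close> times that cube.\<close>
  with c have "preserves_susy k F"
    unfolding c(1) inversion_eq preserves_susy_gmap_iff[OF gmap_data_inverse k]
    by (simp add: deriv_inverse power_mult_distrib) (simp add: field_simps power2_eq_square power4_eq_xxxx)
  then show "F \<in> {F. super_morphism Gsp Gsp F \<and> preserves_susy k F \<and>
      (\<forall>z. z \<noteq> 0 \<longrightarrow> body F (pt z) = pt (inverse z))}"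
    using c by (simp add: super_morphism_inversion) (simp add: inversion_eq body_gmap)
next
  fix F assume "F \<in> {F. super_morphism Gsp Gsp F \<and> preserves_susy k F \<and>
      (\<forall>z. z \<noteq> 0 \<longrightarrow> body F (pt z) = pt (inverse z))}"
  then have F: "super_morphism Gsp Gsp F" "preserves_susy k F"
    and body: "\<And>z. z \<noteq> 0 \<Longrightarrow> body F (pt z) = pt (inverse z)"
    by auto
  from F(1) obtain \<phi> g where d: "gmap_data \<phi> g" "F = gmap \<phi> g"
    by (rule super_morphism_Gsp_cases)
  have \<phi>: "\<phi> z = inverse z" if "z \<noteq> 0" for z
    using body[OF that] that by (simp add: d body_gmap)
  \<comment> \<open>Both sides of the SUSY equation equal minus the inverse cube of
    \<open>z\<close>; multiplication by \<open>z ^ 3\<close> completes the square.\<close>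
  have "(g z * z ^ 2) ^ 2 = - 1" if z: "z \<noteq> 0" for z
  proof -
    \<comment> \<open>\<open>\<phi>\<close> is known to be the inverse off \<open>0\<close> only, so
      derivatives are compared on a neighbourhood of \<open>z\<close> avoiding
      \<open>0\<close>.\<close>
    have ev: "\<forall>\<^sub>F u in nhds z. u \<noteq> 0"
      using z by (intro t1_space_nhds) auto
    have "deriv \<phi> z = - (inverse z ^ 2)"
      unfolding deriv_inverse[OF z, symmetric]
      by (rule deriv_cong_ev[OF eventually_mono[OF ev]]) (simp_all add: \<phi>)
    then have "inverse z * - (inverse z ^ 2) = g z ^ 2 * z"
      using F(2) z \<phi> unfolding d preserves_susy_gmap_iff[OF d(1) k] by metis
    then show ?thesis
      using z by (simp add: power_mult_distrib field_simps power2_eq_square)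
  qed
  then have range: "g z * z ^ 2 \<in> {\<i>, - \<i>}" if "z \<in> - {0}" for z
    using that by (simp add: square_eq_neg_one_iff)
  \<comment> \<open>The sign could so far vary with \<open>z\<close>; a continuous function with
    finitely many values on a connected set is constant.\<close>
  have "(\<lambda>z. g z * z ^ 2) constant_on - {0}"
  proof (rule continuous_finite_range_constant)
    show "connected (- {0 :: complex})"
      by (rule connected_punctured_universe) simp
    show "continuous_on (- {0}) (\<lambda>z. g z * z ^ 2)"
      using d(1) by (intro continuous_on_mult continuous_on_power continuous_on_id)
        (simp add: gmap_data_def holomorphic_on_imp_continuous_on)
    have "(\<lambda>z. g z * z ^ 2) ` (- {0}) \<subseteq> {\<i>, - \<i>}"
      by (rule image_subsetI) (rule range)
    then show "finite ((\<lambda>z. g z * z ^ 2) ` (- {0}))"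
      by (rule finite_subset) simp
  qed
  then obtain c where c: "\<And>z. z \<noteq> 0 \<Longrightarrow> g z * z ^ 2 = c"
    unfolding constant_on_def by blast
  have "g z = c * inverse z ^ 2" if "z \<noteq> 0" for z
    unfolding c[OF that, symmetric] using that by (simp add: field_simps)
  then have "F = inversion c"
    unfolding d inversion_eq using \<phi> by (intro gmap_cong)
  moreover have "c \<in> {\<i>, - \<i>}"
    using range[of 1] c[of 1] by simp
  ultimately show "F \<in> {P_plus, P_minus}"
    by (auto simp: P_plus_def P_minus_def)
qed

section \<open>The group law on points\<close>

text \<open>The underlying map lands in \<open>Gpts\<close>, so the preimage of \<open>Gpts\<close>
  is all of \<open>T\<close> and the pullback acts between global sections.\<close>

lemma T_point_hom:
  assumes "super_morphism T Gsp p"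
  shows "super_hom OG (grade Gsp Gpts) (str T (topspace (pts T))) (grade T (topspace (pts T))) (pull p Gpts)"
proof -
  have "preim T p Gpts = topspace (pts T)"
    using assms by (auto simp: super_morphism_def preim_def continuous_map_def)
  then show ?thesis
    using assms by (metis super_morphism_def openin_Gsp_Gpts)
qed

lemma T_point_coord_grade:
  assumes "super_morphism T Gsp p"
  shows "coord_w p \<in> grade T (topspace (pts T)) False" "coord_eta p \<in> grade T (topspace (pts T)) True"
proof -
  have "gen_w \<in> grade Gsp Gpts False" "gen_eta \<in> grade Gsp Gpts True"
    unfolding Gpts_alt by (simp_all add: gen_w_gsec gen_eta_gsec gsec_in_grade_iff)
  then show "coord_w p \<in> grade T (topspace (pts T)) False" "coord_eta p \<in> grade T (topspace (pts T)) True"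
    using T_point_hom[OF assms] unfolding super_hom_def by (simp_all add: image_subset_iff)
qed

text \<open>Images under the pullback along \<open>p\<close> of identities in \<open>OG\<close>. The
  new even coordinate is described by its product with the old one, the form that
  \<open>inversion_product\<close> takes as input.\<close>

lemma T_point_inversion:
  fixes T :: "('p, 's) super_space" and c :: complex
  assumes p: "super_morphism T Gsp p"
  defines "A \<equiv> str T (topspace (pts T))" and "gr \<equiv> grade T (topspace (pts T))"
    and "p' \<equiv> super_comp T Gsp Gsp (inversion c) p"
  shows "coord_w p' \<in> gr False"
    "coord_w p \<otimes>\<^bsub>A\<^esub> coord_w p' = \<one>\<^bsub>A\<^esub>"
    "coord_eta p' = c \<odot>\<^bsub>A\<^esub> (coord_w p' \<otimes>\<^bsub>A\<^esub> coord_w p' \<otimes>\<^bsub>A\<^esub> coord_eta p)"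
proof -
  have "super_hom OG (grade Gsp Gpts) A gr (pull p Gpts)"
    unfolding A_def gr_def using p by (rule T_point_hom)
  then have hom: "pull p Gpts \<in> ring_hom OG A"
    and smult: "\<And>c a. a \<in> carrier OG \<Longrightarrow> pull p Gpts (c \<odot>\<^bsub>OG\<^esub> a) = c \<odot>\<^bsub>A\<^esub> pull p Gpts a"
    and grade: "\<And>i a. a \<in> grade Gsp Gpts i \<Longrightarrow> pull p Gpts a \<in> gr i"
    unfolding super_hom_def by (simp_all add: image_subset_iff)
  have w: "gen_w \<in> carrier OG" and eta: "gen_eta \<in> carrier OG"
    unfolding Gpts_alt by (simp_all add: gen_w_gsec gen_eta_gsec)
  have preim: "preim Gsp (inversion c) Gpts = Gpts"
    unfolding inversion_eq Gpts_alt preim_gmap by auto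
  have comp: "pull p' Gpts a = pull p Gpts (pull (inversion c) Gpts a)" if "a \<in> carrier OG" for a
    using that unfolding p'_def by (simp add: super_comp_def preim)
  let ?w' = "gsec (- {0}) inverse (\<lambda>_. 0)"
  have w': "?w' \<in> grade Gsp Gpts False" "?w' \<in> carrier OG"
    unfolding Gpts_alt by (simp_all add: gsec_in_grade_iff holomorphic_on_inverse_nonzero)
  have p'_w: "coord_w p' = pull p Gpts ?w'"
    using w by (simp add: comp inversion_eq coord_gmap[OF gmap_data_inverse])
  show "coord_w p' \<in> gr False"
    using w' by (simp add: grade p'_w)
  have "gen_w \<otimes>\<^bsub>OG\<^esub> ?w' = \<one>\<^bsub>OG\<^esub>"
    unfolding Gpts_alt by (simp add: gen_w_gsec one_gsec gsec_eq_iff)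
  then show "coord_w p \<otimes>\<^bsub>A\<^esub> coord_w p' = \<one>\<^bsub>A\<^esub>"
    unfolding p'_w using ring_hom_mult[OF hom w w'(2)] ring_hom_one[OF hom] by simp
  have w'w': "?w' \<otimes>\<^bsub>OG\<^esub> ?w' \<in> carrier OG" "?w' \<otimes>\<^bsub>OG\<^esub> ?w' \<otimes>\<^bsub>OG\<^esub> gen_eta \<in> carrier OG"
    using w' eta monoid.m_closed[OF monoid_str_Gsp[of "- {0}"]] unfolding Gpts_alt by blast+
  have "coord_eta p' = pull p Gpts (c \<odot>\<^bsub>OG\<^esub> (?w' \<otimes>\<^bsub>OG\<^esub> ?w' \<otimes>\<^bsub>OG\<^esub> gen_eta))"
    using eta by (simp add: comp inversion_eq coord_gmap[OF gmap_data_inverse])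
      (simp add: gen_eta_gsec power2_eq_square)
  then show "coord_eta p' = c \<odot>\<^bsub>A\<^esub> (coord_w p' \<otimes>\<^bsub>A\<^esub> coord_w p' \<otimes>\<^bsub>A\<^esub> coord_eta p)"
    unfolding p'_w smult[OF w'w'(2)] ring_hom_mult[OF hom w'w'(1) eta] ring_hom_mult[OF hom w'(2) w'(2)] .
qed

text \<open>In coordinates the claim is a pair of identities between global sections of
  \<open>T\<close>, which \<open>inversion_product\<close> provides.\<close>

lemma hom_on_points_inversion:
  assumes alg: "super_algebra (str T (topspace (pts T))) (grade T (topspace (pts T)))"
    and c: "c ^ 2 = - 1"
  shows "hom_on_points k T (inversion c)"
  unfolding hom_on_points_def
proof (intro allI impI, elim conjE)
  fix p q r
  assume p: "super_morphism T Gsp p" and q: "super_morphism T Gsp q" and r: "super_morphism T Gsp r"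
    and pqr: "is_product k T p q r"
  interpret supercommutative "str T (topspace (pts T))" "grade T (topspace (pts T))"
    using alg by (rule supercommutative.intro)
  note p0 = T_point_coord_grade[OF p] and q0 = T_point_coord_grade[OF q]
  note p = T_point_inversion[OF p, of c] and q = T_point_inversion[OF q, of c] and r = T_point_inversion[OF r, of c]
  note prod = pqr[unfolded is_product_def Let_def]
  \<comment> \<open>Here \<open>a\<close>, \<open>b\<close> and \<open>\<alpha>\<close>,
    \<open>\<beta>\<close> are the even and odd coordinates of the first two points,
    \<open>a'\<close>, \<open>b'\<close> the even coordinates of their images, and \<open>e'\<close>
    that of the image of their product.\<close>
  note inv = inversion_product[OF p0(1) p(1) q0(1) q(1) r(1) p0(2) q0(2) p(2) q(2) r(2)[unfolded conjunct1[OF prod]] c]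
  show "is_product k T (super_comp T Gsp Gsp (inversion c) p) (super_comp T Gsp Gsp (inversion c) q)
      (super_comp T Gsp Gsp (inversion c) r)"
    unfolding is_product_def Let_def p(3) q(3) r(3) conjunct2[OF prod]
    using inv by blast
qed

lemma supergroup_automorphism_inversion:
  assumes c: "c ^ 2 = - 1"
  shows "supergroup_automorphism TYPE(('p, 's) super_space) k (inversion c)"
proof -
  have "c \<noteq> 0"
    using c by auto
  moreover have "hom_on_points k T (inversion c)" if "complex_supermanifold m n T"
    for m n and T :: "('p, 's) super_space"
  proof (rule hom_on_points_inversion[OF _ c])
    have "super_presheaf T"
      using that by (simp add: complex_supermanifold_def super_ringed_space_def)
    then show "super_algebra (str T (topspace (pts T))) (grade T (topspace (pts T)))"
      by (simp add: super_presheaf_def)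
  qed
  ultimately show ?thesis
    by (simp add: supergroup_automorphism_def super_iso_inversion)
qed

text \<open>The equation \<open>c ^ 2 = - 1\<close> links both halves: it makes the map respect the
  group law, and its two roots are the constants allowed by the SUSY-1 structure.\<close>

theorem proposition5p1:
  fixes k :: complex
  assumes "k \<noteq> 0"
  shows "supergroup_automorphism TYPE(('p, 's) super_space) k P_plus \<and>
         supergroup_automorphism TYPE(('p, 's) super_space) k P_minus \<and>
         {F. super_morphism Gsp Gsp F \<and> preserves_susy k F \<and>
             (\<forall>z. z \<noteq> 0 \<longrightarrow> body F (pt z) = pt (inverse z))} = {P_plus, P_minus}"
  using susy_inverting_endomorphisms[OF assms] supergroup_automorphism_inversion[of \<i> k]
    supergroup_automorphism_inversion[of "- \<i>" k]
  by (simp add: P_plus_def P_minus_def)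

end
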